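(* Let $k\{y_1,\ldots,y_l\}$ be a ring of differential polynomials over a differential field $k$ of characteristic zero, with a fixed ranking. Let $\mathbb{A}$ and $\mathbb{B}$ be characteristic sets of characterizable differential ideals $I=[\mathbb{A}]:H_{\mathbb{A}}^\infty$ and $J=[\mathbb{B}]:H_{\mathbb{B}}^\infty$, respectively. Then $I=J$ if and only if all of the following hold: (1) $\mathbb{A}\subset J$; (2) $\mathbb{B}\subset I$; (3) $H_{\mathbb{A}}\notin J$; (4) $H_{\mathbb{B}}\notin I$.
   Context: $\Delta=\{\delta_1,\ldots,\delta_n\}$ is a finite set of commuting derivations, $\Theta$ the free commutative monoid of derivative operators $\delta_1^{k_1}\cdots\delta_n^{k_n}$. $k\{y_1,\ldots,y_l\}$ is the polynomial ring over $k$ in the differential variables $\theta y_j$. $[F]$ is the differential ideal generated by $F$. A ranking is a total order on the differential variables such that $\theta u\geq u$ and ($u\geq v\Rightarrow\theta u\geq\theta v$). The leader $u_f$ of $f\notin k$ is the highest differential variable in $f$; if $d=\deg_{u_f}f$, the initial $I_f$ is the coefficient of $u_f^d$, the separant is $S_f=\partial f/\partial u_f$, and the rank is $u_f^d$. Ranks are compared by $u^{d}>v^{e}$ iff $u>v$, or $u=v$ and $d>e$. $f$ is reduced with respect to $g$ if no proper derivative of $u_g$ appears in $f$ and $\deg_{u_g}f<\deg_{u_g}g$. A set $\mathbb{A}\subset k\{y_1,\ldots,y_l\}\setminus k$ is autoreduced if each element is reduced with respect to all the others; such sets are finite and written in order of increasing rank. $\mathbb{A}=A_1,\ldots,A_r$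 has lower rank than $\mathbb{B}=B_1,\ldots,B_s$ if there is $j\le r,s$ with $\operatorname{rank}A_i=\operatorname{rank}B_i$ for $i<j$ and $\operatorname{rank}A_j<\operatorname{rank}B_j$, or if $r>s$ and $\operatorname{rank}A_i=\operatorname{rank}B_i$ for $1\le i\le s$. A characteristic set of an ideal is an autoreduced subset of it of lowest rank. $H_{\mathbb{A}}$ is the product of the initials and separants of the elements of $\mathbb{A}$, and $K:H_{\mathbb{A}}^\infty=\{a : H_{\mathbb{A}}^m a\in K\text{ for some }m\geq0\}$. A differential ideal $I$ is characterizable if $I=[\mathbb{A}]:H_{\mathbb{A}}^\infty$ for some characteristic set $\mathbb{A}$ of $I$. *)

theory Defs
  imports Complex_Main "HOL-Library.Poly_Mapping" "HOL-Library.Multiset"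
begin

text \<open>
  The index type \<open>'d\<close> stands for \<open>{1..n}\<close> and \<open>'y\<close> for \<open>{1..l}\<close>; both are finite types in the
  theorem. A derivative operator is a multiset over \<open>'d\<close> (the free commutative monoid), in which
  the count of \<open>i\<close> is the exponent of the \<open>i\<close>-th derivation and composition is addition. The pair
  \<open>(\<theta>, j)\<close> is the differential variable \<open>\<theta> y\<^sub>j\<close>. A differential polynomial maps each
  monomial, that is, each finitely supported exponent function, to its coefficient.
\<close>

type_synonym 'd dop = "'d multiset"
type_synonym ('d, 'y) dvar = "'d dop \<times> 'y"
type_synonym ('d, 'y) dmonom = "('d, 'y) dvar \<Rightarrow>\<^sub>0 nat"
type_synonym ('d, 'y, 'k) dpoly = "('d, 'y) dmonom \<Rightarrow>\<^sub>0 'k"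

definition apply_op :: "'d dop \<Rightarrow> ('d, 'y) dvar \<Rightarrow> ('d, 'y) dvar" where
  "apply_op \<theta> u = (\<theta> + fst u, snd u)"

definition derivation :: "('a::comm_ring_1 \<Rightarrow> 'a) \<Rightarrow> bool" where
  "derivation D \<longleftrightarrow>
     (\<forall>x y. D (x + y) = D x + D y) \<and> (\<forall>x y. D (x * y) = D x * y + x * D y)"

definition differential_field :: "('d \<Rightarrow> 'k::field \<Rightarrow> 'k) \<Rightarrow> bool" where
  "differential_field \<delta> \<longleftrightarrow>
     (\<forall>i. derivation (\<delta> i)) \<and> (\<forall>i j x. \<delta> i (\<delta> j x) = \<delta> j (\<delta> i x))"

definition dconst :: "'k::zero \<Rightarrow> ('d, 'y, 'k) dpoly" where
  "dconst c = Poly_Mapping.single 0 c"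

definition dvar_poly :: "('d, 'y) dvar \<Rightarrow> ('d, 'y, 'k::zero_neq_one) dpoly" where
  "dvar_poly u = Poly_Mapping.single (Poly_Mapping.single u 1) 1"

definition dvars :: "('d, 'y, 'k::zero) dpoly \<Rightarrow> ('d, 'y) dvar set" where
  "dvars f = (\<Union>m\<in>Poly_Mapping.keys f. Poly_Mapping.keys m)"

text \<open>The convention is that the zero polynomial has degree 0.\<close>

definition deg_in :: "('d, 'y) dvar \<Rightarrow> ('d, 'y, 'k::zero) dpoly \<Rightarrow> nat" where
  "deg_in u f = Max (insert 0 ((\<lambda>m. Poly_Mapping.lookup m u) ` Poly_Mapping.keys f))"

definition coeff_in ::
    "('d, 'y) dvar \<Rightarrow> nat \<Rightarrow> ('d, 'y, 'k::comm_ring_1) dpoly \<Rightarrow> ('d, 'y, 'k) dpoly" where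
  "coeff_in u d f =
     (\<Sum>m\<in>{m \<in> Poly_Mapping.keys f. Poly_Mapping.lookup m u = d}.
        Poly_Mapping.single (m - Poly_Mapping.single u d) (Poly_Mapping.lookup f m))"

text \<open>
  The subtraction of exponents is truncated, but a monomial not containing \<open>u\<close> gets the
  coefficient 0.
\<close>

definition pderiv_in ::
    "('d, 'y) dvar \<Rightarrow> ('d, 'y, 'k::comm_ring_1) dpoly \<Rightarrow> ('d, 'y, 'k) dpoly" where
  "pderiv_in u f =
     (\<Sum>m\<in>Poly_Mapping.keys f.
        Poly_Mapping.single (m - Poly_Mapping.single u 1)
          (of_nat (Poly_Mapping.lookup m u) * Poly_Mapping.lookup f m))"

text \<open>
  The derivation \<open>\<delta> i\<close> of the coefficient field, extended to differential polynomials by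
  \<open>\<theta> y\<^sub>j \<mapsto> \<delta>\<^sub>i \<theta> y\<^sub>j\<close>: differentiate the coefficients and apply the
  chain rule to the variables.
\<close>

definition dext ::
    "('d \<Rightarrow> 'k \<Rightarrow> 'k) \<Rightarrow> 'd \<Rightarrow> ('d, 'y, 'k::comm_ring_1) dpoly \<Rightarrow> ('d, 'y, 'k) dpoly" where
  "dext \<delta> i f =
     (\<Sum>m\<in>Poly_Mapping.keys f. Poly_Mapping.single m (\<delta> i (Poly_Mapping.lookup f m))) +
     (\<Sum>u\<in>dvars f. pderiv_in u f * dvar_poly (apply_op {#i#} u))"

text \<open>An ideal is a submodule of the ring regarded as a module over itself.\<close>

definition differential_ideal ::
    "('d \<Rightarrow> 'k \<Rightarrow> 'k) \<Rightarrow> ('d, 'y, 'k::comm_ring_1) dpoly set \<Rightarrow> bool" where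
  "differential_ideal \<delta> K \<longleftrightarrow> module.subspace (*) K \<and> (\<forall>i. \<forall>f\<in>K. dext \<delta> i f \<in> K)"

definition differential_ideal_gen ::
    "('d \<Rightarrow> 'k \<Rightarrow> 'k) \<Rightarrow> ('d, 'y, 'k::comm_ring_1) dpoly set \<Rightarrow> ('d, 'y, 'k) dpoly set" where
  "differential_ideal_gen \<delta> F = differential_ideal \<delta> hull F"

definition saturation :: "'a::comm_ring_1 set \<Rightarrow> 'a \<Rightarrow> 'a set" where
  "saturation K h = {a. \<exists>m::nat. h ^ m * a \<in> K}"

text \<open>\<open>(u, v) \<in> R\<close> means that \<open>u\<close> is lower than or equal to \<open>v\<close>.\<close>

definition ranking :: "('d, 'y) dvar rel \<Rightarrow> bool" where
  "ranking R \<longleftrightarrow> linear_order R \<and>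
     (\<forall>\<theta> u. (u, apply_op \<theta> u) \<in> R) \<and>
     (\<forall>\<theta> u v. (v, u) \<in> R \<longrightarrow> (apply_op \<theta> v, apply_op \<theta> u) \<in> R)"

text \<open>The leader and the notions derived from it are meaningful only for polynomials outside \<open>k\<close>.\<close>

definition leader :: "('d, 'y) dvar rel \<Rightarrow> ('d, 'y, 'k::zero) dpoly \<Rightarrow> ('d, 'y) dvar" where
  "leader R f = (THE u. u \<in> dvars f \<and> (\<forall>v\<in>dvars f. (v, u) \<in> R))"

definition initial ::
    "('d, 'y) dvar rel \<Rightarrow> ('d, 'y, 'k::comm_ring_1) dpoly \<Rightarrow> ('d, 'y, 'k) dpoly" where
  "initial R f = coeff_in (leader R f) (deg_in (leader R f) f) f"

definition separant ::
    "('d, 'y) dvar rel \<Rightarrow> ('d, 'y, 'k::comm_ring_1) dpoly \<Rightarrow> ('d, 'y, 'k) dpoly" where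
  "separant R f = pderiv_in (leader R f) f"

text \<open>The pair \<open>(u, d)\<close> represents the rank \<open>u\<^sup>d\<close>.\<close>

definition poly_rank ::
    "('d, 'y) dvar rel \<Rightarrow> ('d, 'y, 'k::zero) dpoly \<Rightarrow> ('d, 'y) dvar \<times> nat" where
  "poly_rank R f = (leader R f, deg_in (leader R f) f)"

definition rank_less ::
    "('d, 'y) dvar rel \<Rightarrow> ('d, 'y) dvar \<times> nat \<Rightarrow> ('d, 'y) dvar \<times> nat \<Rightarrow> bool" where
  "rank_less R p q \<longleftrightarrow>
     (fst p \<noteq> fst q \<and> (fst p, fst q) \<in> R) \<or> (fst p = fst q \<and> snd p < snd q)"

definition reduced ::
    "('d, 'y) dvar rel \<Rightarrow> ('d, 'y, 'k::zero) dpoly \<Rightarrow> ('d, 'y, 'k) dpoly \<Rightarrow> bool" where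
  "reduced R f g \<longleftrightarrow>
     (\<forall>\<theta>. \<theta> \<noteq> {#} \<longrightarrow> apply_op \<theta> (leader R g) \<notin> dvars f) \<and>
     deg_in (leader R g) f < deg_in (leader R g) g"

definition autoreduced :: "('d, 'y) dvar rel \<Rightarrow> ('d, 'y, 'k::zero) dpoly set \<Rightarrow> bool" where
  "autoreduced R A \<longleftrightarrow> A \<inter> range dconst = {} \<and> (\<forall>f\<in>A. \<forall>g\<in>A. f \<noteq> g \<longrightarrow> reduced R f g)"

text \<open>
  \<open>as\<close> lists the elements of \<open>A\<close> in order of increasing rank. Distinct elements of an autoreduced
  set have distinct ranks, so the strict order loses nothing.
\<close>

definition enumerates ::
    "('d, 'y) dvar rel \<Rightarrow> ('d, 'y, 'k::zero) dpoly list \<Rightarrow> ('d, 'y, 'k) dpoly set \<Rightarrow> bool" where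
  "enumerates R as A \<longleftrightarrow>
     set as = A \<and> sorted_wrt (\<lambda>f g. rank_less R (poly_rank R f) (poly_rank R g)) as"

definition list_lower_rank ::
    "('d, 'y) dvar rel \<Rightarrow> ('d, 'y, 'k::zero) dpoly list \<Rightarrow> ('d, 'y, 'k) dpoly list \<Rightarrow> bool" where
  "list_lower_rank R as bs \<longleftrightarrow>
     (\<exists>j. j < length as \<and> j < length bs \<and>
        (\<forall>i<j. poly_rank R (as ! i) = poly_rank R (bs ! i)) \<and>
        rank_less R (poly_rank R (as ! j)) (poly_rank R (bs ! j))) \<or>
     (length as > length bs \<and>
        (\<forall>i<length bs. poly_rank R (as ! i) = poly_rank R (bs ! i)))"

definition lower_rank ::
    "('d, 'y) dvar rel \<Rightarrow> ('d, 'y, 'k::zero) dpoly set \<Rightarrow> ('d, 'y, 'k) dpoly set \<Rightarrow> bool" where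
  "lower_rank R A B \<longleftrightarrow>
     (\<exists>as bs. enumerates R as A \<and> enumerates R bs B \<and> list_lower_rank R as bs)"

definition characteristic_set ::
    "('d, 'y) dvar rel \<Rightarrow> ('d, 'y, 'k::zero) dpoly set \<Rightarrow> ('d, 'y, 'k) dpoly set \<Rightarrow> bool" where
  "characteristic_set R A K \<longleftrightarrow> autoreduced R A \<and> A \<subseteq> K \<and>
     (\<forall>B. autoreduced R B \<and> B \<subseteq> K \<longrightarrow> \<not> lower_rank R B A)"

text \<open>
  By Dickson's lemma autoreduced sets over finitely many derivations and differential
  indeterminates are finite, so this is a genuine product for each of them.
\<close>

definition H_prod ::
    "('d, 'y) dvar rel \<Rightarrow> ('d, 'y, 'k::comm_ring_1) dpoly set \<Rightarrow> ('d, 'y, 'k) dpoly" where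
  "H_prod R A = (\<Prod>f\<in>A. initial R f * separant R f)"

definition characterizable ::
    "('d \<Rightarrow> 'k \<Rightarrow> 'k) \<Rightarrow> ('d, 'y) dvar rel \<Rightarrow> ('d, 'y, 'k::comm_ring_1) dpoly set \<Rightarrow> bool" where
  "characterizable \<delta> R K \<longleftrightarrow> differential_ideal \<delta> K \<and>
     (\<exists>A. characteristic_set R A K \<and> K = saturation (differential_ideal_gen \<delta> A) (H_prod R A))"

end

theory Submission
  imports Defs
begin

text \<open>
  If \<open>\<A> \<subseteq> J\<close> and \<open>\<B> \<subseteq> I\<close>, minimality of the two characteristic sets forces them to have the same
  ranks, so being reduced with respect to \<open>\<A>\<close> and to \<open>\<B>\<close> means the same. The remainder \<open>r\<close> of some
  \<open>f \<in> I\<close> under Ritt reduction by \<open>\<B>\<close> lies in \<open>I\<close> and is reduced with respect to the characteristic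
  set \<open>\<A>\<close> of \<open>I\<close>. Hence \<open>r\<close> is a constant, which vanishes because \<open>I\<close> is not the unit ideal, and so
  \<open>f \<in> [\<B>] : H\<^sub>\<B>\<^sup>\<infinity> = J\<close>. Conversely, \<open>H\<^sub>\<A> \<in> I = [\<A>] : H\<^sub>\<A>\<^sup>\<infinity>\<close> would make \<open>I\<close> the unit ideal. Its
  characteristic sets consist of one linear polynomial \<open>\<alpha> y\<^sub>j + \<beta>\<close> over the field for each \<open>j\<close>,
  and these have a common differential zero at which \<open>H\<^sub>\<A>\<close> does not vanish, a contradiction.
\<close>

subsection \<open>Degrees and partial derivatives\<close>

lemma deg_in_le_iff: "deg_in w f \<le> n \<longleftrightarrow> (\<forall>m\<in>Poly_Mapping.keys f. Poly_Mapping.lookup m w \<le> n)"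
  by (simp add: deg_in_def)

lemma lookup_le_deg_in: "m \<in> Poly_Mapping.keys f \<Longrightarrow> Poly_Mapping.lookup m w \<le> deg_in w f"
  using deg_in_le_iff by blast

lemma deg_in_eq_0_iff: "deg_in w f = 0 \<longleftrightarrow> w \<notin> dvars f"
  using deg_in_le_iff[of w f 0] by (auto simp: dvars_def in_keys_iff)

lemma finite_dvars [simp]: "finite (dvars f)"
  by (simp add: dvars_def)

lemma deg_in_add_le:
  assumes "deg_in w f \<le> n" "deg_in w g \<le> n"
  shows "deg_in w (f + g) \<le> n"
  using assms keys_add[of f g] unfolding deg_in_le_iff by blast

lemma deg_in_uminus [simp]: "deg_in w (- f :: ('d, 'y, 'k::comm_ring_1) dpoly) = deg_in w f"
proof -
  have "Poly_Mapping.keys (- f) = Poly_Mapping.keys f"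
    by (auto simp: in_keys_iff)
  then show ?thesis by (simp add: deg_in_def)
qed

lemma deg_in_diff_le:
  fixes f g :: "('d, 'y, 'k::comm_ring_1) dpoly"
  assumes "deg_in w f \<le> n" "deg_in w g \<le> n"
  shows "deg_in w (f - g) \<le> n"
  using deg_in_add_le[of w f n "- g"] assms by simp

lemma deg_in_zero [simp]: "deg_in w 0 = 0"
  by (simp add: deg_in_def)

lemma deg_in_sum_le: "(\<And>x. x \<in> X \<Longrightarrow> deg_in w (f x) \<le> n) \<Longrightarrow> deg_in w (sum f X) \<le> n"
  by (induction X rule: infinite_finite_induct) (auto intro: deg_in_add_le)

lemma deg_in_single_le: "Poly_Mapping.lookup m w \<le> n \<Longrightarrow> deg_in w (Poly_Mapping.single m c) \<le> n"
  by (simp add: deg_in_le_iff)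

lemma deg_in_mult_le:
  fixes f g :: "('d, 'y, 'k::comm_ring_1) dpoly"
  shows "deg_in w (f * g) \<le> deg_in w f + deg_in w g"
  unfolding deg_in_le_iff
proof
  fix m assume "m \<in> Poly_Mapping.keys (f * g)"
  then obtain a b where "m = a + b" "a \<in> Poly_Mapping.keys f" "b \<in> Poly_Mapping.keys g"
    using keys_mult[of f g] by blast
  then show "Poly_Mapping.lookup m w \<le> deg_in w f + deg_in w g"
    by (simp add: lookup_add add_mono lookup_le_deg_in)
qed

lemma dvar_poly_power:
  "dvar_poly v ^ n = (Poly_Mapping.single (Poly_Mapping.single v n) 1 :: ('d, 'y, 'k::comm_ring_1) dpoly)"
  by (induction n) (simp_all add: dvar_poly_def mult_single flip: single_add)

lemma deg_in_dvar_power_le: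
  "deg_in w (dvar_poly v ^ n :: ('d, 'y, 'k::comm_ring_1) dpoly) \<le> (if w = v then n else 0)"
  unfolding dvar_poly_power by (rule deg_in_single_le) (simp add: lookup_single when_def)

lemma deg_in_dvar_poly_le:
  "deg_in w (dvar_poly v :: ('d, 'y, 'k::comm_ring_1) dpoly) \<le> (if w = v then 1 else 0)"
  using deg_in_dvar_power_le[of w v 1] by simp

lemma sum_single_lookup:
  "(\<Sum>m\<in>Poly_Mapping.keys f. Poly_Mapping.single m (Poly_Mapping.lookup f m)) = f"
  by (rule poly_mapping_eqI)
    (auto simp: lookup_sum lookup_single when_def in_keys_iff)

text \<open>Subtraction of exponents is truncated, so it can be undone only if the exponent of
  \<open>u\<close> is at least \<open>d\<close>.\<close>

lemma monom_diff_add: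
  assumes "d \<le> Poly_Mapping.lookup m (u :: ('d, 'y) dvar)"
  shows "m - Poly_Mapping.single u d + Poly_Mapping.single u d = (m :: ('d, 'y) dmonom)"
  by (rule poly_mapping_eqI) (use assms in \<open>auto simp: lookup_add lookup_minus lookup_single when_def\<close>)

lemma deg_in_coeff_in_le: "deg_in w (coeff_in u d f) \<le> deg_in w f"
  unfolding coeff_in_def
  by (intro deg_in_sum_le deg_in_single_le)
    (auto simp: lookup_minus intro!: le_trans[OF diff_le_self] lookup_le_deg_in)

lemma deg_in_coeff_in_self [simp]: "deg_in u (coeff_in u d f) = 0"
  unfolding coeff_in_def
  by (rule le_zero_eq[THEN iffD1], intro deg_in_sum_le deg_in_single_le) (auto simp: lookup_minus)

text \<open>The tail \<open>T\<close> collects the monomials whose exponent of \<open>v\<close> is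
  below \<open>d\<close>. For \<open>d = 0\<close> no tail could have degree less than
  \<open>d\<close>.\<close>

lemma leading_coeff_split:
  fixes f :: "('d, 'y, 'k::comm_ring_1) dpoly"
  assumes "deg_in v f = d" "0 < d"
  obtains T where "f = coeff_in v d f * dvar_poly v ^ d + T" "deg_in v T < d"
    "\<And>w. deg_in w T \<le> deg_in w f"
proof -
  let ?K = "Poly_Mapping.keys f"
  let ?L = "{m \<in> ?K. Poly_Mapping.lookup m v = d}"
  let ?s = "\<lambda>m. Poly_Mapping.single m (Poly_Mapping.lookup f m)"
  define T where "T = sum ?s (?K - ?L)"
  have lead: "coeff_in v d f * dvar_poly v ^ d = sum ?s ?L"
    unfolding coeff_in_def dvar_poly_power sum_distrib_right mult_single
    by (rule sum.cong) (auto simp: monom_diff_add)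
  have "sum ?s ?K = T + sum ?s ?L"
    unfolding T_def by (rule sum.subset_diff) auto
  then have f: "f = coeff_in v d f * dvar_poly v ^ d + T"
    unfolding lead sum_single_lookup add.commute[of T] .
  have "deg_in v T \<le> d - 1"
    unfolding T_def
  proof (intro deg_in_sum_le deg_in_single_le)
    fix m assume m: "m \<in> ?K - ?L"
    then have "Poly_Mapping.lookup m v \<le> d" using assms lookup_le_deg_in[of m f v] by auto
    with m show "Poly_Mapping.lookup m v \<le> d - 1" by auto
  qed
  with \<open>0 < d\<close> have "deg_in v T < d" by simp
  moreover have "deg_in w T \<le> deg_in w f" for w
    unfolding T_def by (intro deg_in_sum_le deg_in_single_le) (auto intro: lookup_le_deg_in)
  ultimately show thesis by (rule that[OF f])
qed

section \<open>Partial derivatives\<close>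

text \<open>Cancellation can shrink the support of a sum, but terms outside the support contribute
  \<open>F m 0 = 0\<close>, so additivity in the coefficient suffices.\<close>

lemma sum_keys_sum:
  fixes F :: "'a \<Rightarrow> 'k::comm_monoid_add \<Rightarrow> 'c::comm_monoid_add"
  assumes "\<And>m. F m 0 = 0" "\<And>m a b. F m (a + b) = F m a + F m b"
  shows "(\<Sum>m\<in>Poly_Mapping.keys (sum f X). F m (Poly_Mapping.lookup (sum f X) m)) =
    (\<Sum>x\<in>X. \<Sum>m\<in>Poly_Mapping.keys (f x). F m (Poly_Mapping.lookup (f x) m))"
  by (induction X rule: infinite_finite_induct)
    (simp_all add: setsum_keys_plus_distrib[where f = F] assms)

lemma pderiv_in_sum: "pderiv_in u (sum f X) = (\<Sum>x\<in>X. pderiv_in u (f x))"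
  unfolding pderiv_in_def by (rule sum_keys_sum) (simp_all add: distrib_left single_add)

lemma pderiv_in_add: "pderiv_in u (f + g) = pderiv_in u f + pderiv_in u g"
  unfolding pderiv_in_def by (rule setsum_keys_plus_distrib) (simp_all add: distrib_left single_add)

lemma pderiv_in_single:
  "pderiv_in u (Poly_Mapping.single m c) =
    Poly_Mapping.single (m - Poly_Mapping.single u 1) (of_nat (Poly_Mapping.lookup m u) * c)"
  by (simp add: pderiv_in_def)

lemma pderiv_in_eq_0: "deg_in u f = 0 \<Longrightarrow> pderiv_in u f = 0"
  unfolding pderiv_in_def by (rule sum.neutral) (use lookup_le_deg_in[of _ f u] in force)

lemma deg_in_pderiv_in_le: "deg_in w (pderiv_in u f) \<le> deg_in w f"
  unfolding pderiv_in_def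
  by (intro deg_in_sum_le deg_in_single_le)
    (auto simp: lookup_minus intro!: le_trans[OF diff_le_self] lookup_le_deg_in)

text \<open>Multiplication by the variable raises its exponent in every monomial of \<open>S\<close>
  from 0 to 1, and differentiation undoes this with the factor 1.\<close>

lemma pderiv_in_linear:
  fixes S T :: "('d, 'y, 'k::comm_ring_1) dpoly"
  assumes "deg_in v S = 0" "deg_in v T = 0"
  shows "pderiv_in v (S * dvar_poly v + T) = S"
proof -
  let ?v = "Poly_Mapping.single v (1::nat)"
  have "S * dvar_poly v =
      (\<Sum>m\<in>Poly_Mapping.keys S. Poly_Mapping.single (m + ?v) (Poly_Mapping.lookup S m))"
    using arg_cong[OF sum_single_lookup[of S], of "\<lambda>p. p * dvar_poly v"]
    by (simp add: sum_distrib_right dvar_poly_def mult_single)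
  then have "pderiv_in v (S * dvar_poly v) =
      (\<Sum>m\<in>Poly_Mapping.keys S. pderiv_in v (Poly_Mapping.single (m + ?v) (Poly_Mapping.lookup S m)))"
    by (simp add: pderiv_in_sum)
  also have "\<dots> = (\<Sum>m\<in>Poly_Mapping.keys S. Poly_Mapping.single m (Poly_Mapping.lookup S m))"
  proof (rule sum.cong)
    fix m assume "m \<in> Poly_Mapping.keys S"
    then have "Poly_Mapping.lookup m v = 0"
      using lookup_le_deg_in[of m S v] assms(1) by simp
    then show "pderiv_in v (Poly_Mapping.single (m + ?v) (Poly_Mapping.lookup S m)) =
        Poly_Mapping.single m (Poly_Mapping.lookup S m)"
      by (simp add: pderiv_in_single lookup_add)
  qed simp
  finally show ?thesis
    using assms(2) by (simp add: pderiv_in_add pderiv_in_eq_0 sum_single_lookup)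
qed

lemma dvars_empty_iff: "dvars f = {} \<longleftrightarrow> f \<in> range dconst"
proof
  assume "dvars f = {}"
  then have "Poly_Mapping.keys f \<subseteq> {0}"
    by (auto simp: dvars_def)
  then have "f = dconst (Poly_Mapping.lookup f 0)"
    by (intro poly_mapping_eqI) (auto simp: dconst_def lookup_single when_def in_keys_iff)
  then show "f \<in> range dconst" by blast
qed (auto simp: dvars_def dconst_def split: if_splits)

section \<open>Ideals and generated differential ideals\<close>

lemma ideal_iff:
  "module.subspace (*) (K :: 'a::comm_ring_1 set) \<longleftrightarrow>
    0 \<in> K \<and> (\<forall>x\<in>K. \<forall>y\<in>K. x + y \<in> K) \<and> (\<forall>c. \<forall>x\<in>K. c * x \<in> K)"
proof -
  have "module ((*) :: 'a \<Rightarrow> 'a \<Rightarrow> 'a)"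
    by unfold_locales (simp_all add: algebra_simps)
  then show ?thesis by (rule module.subspace_def)
qed

lemma differential_idealD:
  assumes "differential_ideal \<delta> K"
  shows "0 \<in> K" "\<And>f g. f \<in> K \<Longrightarrow> g \<in> K \<Longrightarrow> f + g \<in> K" "\<And>c f. f \<in> K \<Longrightarrow> c * f \<in> K"
    "\<And>f g. f \<in> K \<Longrightarrow> g \<in> K \<Longrightarrow> f - g \<in> K" "\<And>i f. f \<in> K \<Longrightarrow> dext \<delta> i f \<in> K"
proof -
  show "0 \<in> K" and add: "\<And>f g. f \<in> K \<Longrightarrow> g \<in> K \<Longrightarrow> f + g \<in> K"
    and mult: "\<And>c f. f \<in> K \<Longrightarrow> c * f \<in> K" and "\<And>i f. f \<in> K \<Longrightarrow> dext \<delta> i f \<in> K"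
    using assms by (auto simp: differential_ideal_def ideal_iff)
  show "f - g \<in> K" if "f \<in> K" "g \<in> K" for f g
    using add[OF that(1) mult[OF that(2), of "- 1"]] by simp
qed

lemma differential_ideal_gen_ideal: "differential_ideal \<delta> (differential_ideal_gen \<delta> F)"
  unfolding differential_ideal_gen_def
  by (rule hull_in) (auto simp: differential_ideal_def ideal_iff)

lemma differential_ideal_gen_superset: "F \<subseteq> differential_ideal_gen \<delta> F"
  unfolding differential_ideal_gen_def by (rule hull_subset)

lemma differential_ideal_gen_minimal:
  "differential_ideal \<delta> K \<Longrightarrow> F \<subseteq> K \<Longrightarrow> differential_ideal_gen \<delta> F \<subseteq> K"
  unfolding differential_ideal_gen_def by (rule hull_minimal)

subsection \<open>Dickson's lemma and rankings\<close>

lemma mono_subseq_nat: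
  fixes s :: "nat \<Rightarrow> nat"
  shows "\<exists>\<phi> :: nat \<Rightarrow> nat. strict_mono \<phi> \<and> mono (s \<circ> \<phi>)"
proof -
  obtain \<phi> :: "nat \<Rightarrow> nat" where \<phi>: "strict_mono \<phi>" "monoseq (\<lambda>n. s (\<phi> n))"
    using seq_monosub[of s] by blast
  show ?thesis
  proof (cases "incseq (\<lambda>n. s (\<phi> n))")
    case True
    then have "mono (s \<circ> \<phi>)" by (simp add: comp_def)
    with \<phi>(1) show ?thesis by blast
  next
    case False
    with \<phi>(2) have dec: "decseq (\<lambda>n. s (\<phi> n))" by (simp add: monoseq_iff)
    \<comment> \<open>A nonincreasing sequence of naturals is constant from an index on at which it
      attains its minimum.\<close>
    define N where "N = (ARG_MIN (\<lambda>n. s (\<phi> n)) n. True)"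
    have min: "s (\<phi> N) \<le> s (\<phi> n)" for n
      unfolding N_def by (rule arg_min_nat_le) simp
    have "s (\<phi> (n + N)) = s (\<phi> N)" for n
      using min decseqD[OF dec, of N "n + N"] by (simp add: antisym)
    then have "mono (s \<circ> (\<lambda>n. \<phi> (n + N)))"
      by (simp add: mono_def)
    moreover have "strict_mono (\<lambda>n. \<phi> (n + N))"
      using \<phi>(1) by (simp add: strict_mono_def)
    ultimately show ?thesis by blast
  qed
qed

text \<open>The coordinates are made monotone one after the other; passing to a further subsequence
  keeps the earlier ones monotone.\<close>

lemma dickson_finite:
  fixes g :: "nat \<Rightarrow> 'c \<Rightarrow> nat"
  assumes "finite D"
  shows "\<exists>\<phi> :: nat \<Rightarrow> nat. strict_mono \<phi> \<and> (\<forall>d\<in>D. mono (\<lambda>n. g (\<phi> n) d))"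
  using assms
proof (induction D)
  case empty
  show ?case by (intro exI[of _ "\<lambda>n. n"]) (simp add: strict_mono_def)
next
  case (insert d D)
  then obtain \<phi> :: "nat \<Rightarrow> nat" where \<phi>: "strict_mono \<phi>" "\<forall>d\<in>D. mono (\<lambda>n. g (\<phi> n) d)" by blast
  obtain \<psi> :: "nat \<Rightarrow> nat" where \<psi>: "strict_mono \<psi>" "mono ((\<lambda>n. g (\<phi> n) d) \<circ> \<psi>)"
    using mono_subseq_nat by blast
  have "strict_mono (\<phi> \<circ> \<psi>)"
    using \<phi>(1) \<psi>(1) by (rule strict_mono_o)
  moreover have "mono (\<lambda>n. g ((\<phi> \<circ> \<psi>) n) e)" if "e \<in> insert d D" for e
    using that \<phi>(2) \<psi> by (auto simp: mono_def strict_mono_less_eq)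
  ultimately show ?case by blast
qed

text \<open>Finiteness of autoreduced sets and well-foundedness of rankings both rest on this form
  of Dickson's lemma.\<close>

lemma dickson_dvar:
  fixes f :: "nat \<Rightarrow> ('d::finite, 'y::finite) dvar"
  shows "\<exists>i j \<theta>. i < j \<and> f j = apply_op \<theta> (f i)"
proof -
  \<comment> \<open>The indicator of the indeterminate is treated as a further exponent.\<close>
  define g :: "nat \<Rightarrow> 'd + 'y \<Rightarrow> nat" where
    "g n c = (case c of Inl d \<Rightarrow> count (fst (f n)) d | Inr y \<Rightarrow> of_bool (snd (f n) = y))" for n c
  obtain \<phi> :: "nat \<Rightarrow> nat" where \<phi>: "strict_mono \<phi>" "\<And>c. mono (\<lambda>n. g (\<phi> n) c)"
    using dickson_finite[of UNIV g] by fastforce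
  let ?i = "\<phi> 0" and ?j = "\<phi> 1"
  have le: "g ?i c \<le> g ?j c" for c
    using \<phi>(2)[of c] by (simp add: mono_def)
  have "count (fst (f ?i)) d \<le> count (fst (f ?j)) d" for d
    using le[of "Inl d"] by (simp add: g_def)
  then have "fst (f ?i) \<subseteq># fst (f ?j)" by (simp add: subseteq_mset_def)
  \<comment> \<open>The indicator of the indeterminate of \<open>f ?i\<close> is 1 at
    \<open>?i\<close>, hence by monotonicity also at \<open>?j\<close>.\<close>
  moreover have "snd (f ?j) = snd (f ?i)"
    using le[of "Inr (snd (f ?i))"] by (simp add: g_def of_bool_def split: if_splits)
  ultimately have "f ?j = apply_op (fst (f ?j) - fst (f ?i)) (f ?i)"
    by (simp add: apply_op_def prod_eq_iff)
  moreover have "?i < ?j" using \<phi>(1) by (simp add: strict_mono_less)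
  ultimately show ?thesis by blast
qed

text \<open>In an infinite set one leader would be a derivative of another. If the two coincide,
  each degree would be less than the other; if the derivative is proper, \<open>a j\<close> could
  not contain its own leader.\<close>

lemma autoreduced_finite:
  fixes A :: "('d::finite, 'y::finite, 'k::zero) dpoly set"
  assumes "autoreduced R A"
  shows "finite A"
proof (rule ccontr)
  assume "infinite A"
  then obtain a :: "nat \<Rightarrow> _" where a: "inj a" "range a \<subseteq> A"
    using infinite_countable_subset by blast
  obtain i j \<theta> where ij: "i < j" "leader R (a j) = apply_op \<theta> (leader R (a i))"
    using dickson_dvar[of "\<lambda>n. leader R (a n)"] by blast
  have "a i \<noteq> a j" using a(1) ij(1) by (auto dest: injD)
  moreover have "a i \<in> A" "a j \<in> A" using a(2) by auto
  ultimately have red: "reduced R (a j) (a i)" "reduced R (a i) (a j)"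
    using assms unfolding autoreduced_def by simp_all
  show False
  proof (cases "\<theta> = {#}")
    case True
    then show False using red ij(2) by (auto simp: reduced_def apply_op_def)
  next
    case False
    then have "deg_in (leader R (a j)) (a j) = 0"
      using red(1) ij(2) by (auto simp: reduced_def deg_in_eq_0_iff)
    then show False using red(2) by (simp add: reduced_def)
  qed
qed

section \<open>Rankings, their well-foundedness, and leaders\<close>

lemma apply_op_empty [simp]: "apply_op {#} u = u"
  by (simp add: apply_op_def)

lemma apply_op_apply_op: "apply_op \<theta> (apply_op \<eta> u) = apply_op (\<theta> + \<eta>) u"
  by (simp add: apply_op_def ac_simps)

lemma apply_op_inject [simp]: "apply_op \<theta> u = apply_op \<theta> v \<longleftrightarrow> u = v"
  by (auto simp: apply_op_def prod_eq_iff)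

lemma apply_op_eq_self_iff [simp]: "apply_op \<theta> u = u \<longleftrightarrow> \<theta> = {#}" "u = apply_op \<theta> u \<longleftrightarrow> \<theta> = {#}"
  by (auto simp: apply_op_def prod_eq_iff)

locale ranked =
  fixes R :: "('d::finite, 'y::finite) dvar rel"
  assumes ranking: "ranking R"
begin

definition less :: "('d, 'y) dvar \<Rightarrow> ('d, 'y) dvar \<Rightarrow> bool"  (infix \<open>\<prec>\<close> 50) where
  "u \<prec> v \<longleftrightarrow> u \<noteq> v \<and> (u, v) \<in> R"

lemma less_irrefl [simp]: "\<not> u \<prec> u"
  by (simp add: less_def)

lemma linear_order: "trans R" "antisym R" "total R" "refl R"
  using ranking unfolding ranking_def linear_order_on_def partial_order_on_def preorder_on_def
  by simp_all

lemma rank_antisym: "(u, v) \<in> R \<Longrightarrow> (v, u) \<in> R \<Longrightarrow> u = v"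
  using linear_order(2) by (rule antisymD)

lemma rank_trans: "(u, v) \<in> R \<Longrightarrow> (v, w) \<in> R \<Longrightarrow> (u, w) \<in> R"
  using linear_order(1) by (rule transD)

lemma rank_refl [simp]: "(u, u) \<in> R"
  using linear_order(4) by (rule reflD)

lemma less_trans: "u \<prec> v \<Longrightarrow> v \<prec> w \<Longrightarrow> u \<prec> w"
  unfolding less_def using rank_trans[of u v w] rank_antisym[of u v] by auto

lemma less_linear: "u \<prec> v \<or> u = v \<or> v \<prec> u"
  using linear_order(3) unfolding total_on_def less_def by blast

lemma rank_apply_op: "(u, apply_op \<theta> u) \<in> R"
  using ranking unfolding ranking_def by blast

lemma less_apply_op: "\<theta> \<noteq> {#} \<Longrightarrow> u \<prec> apply_op \<theta> u"
  using rank_apply_op by (simp add: less_def)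

lemma apply_op_mono: "u \<prec> v \<Longrightarrow> apply_op \<theta> u \<prec> apply_op \<theta> v"
  using ranking unfolding ranking_def less_def by (metis apply_op_inject)

text \<open>By Dickson's lemma a descending chain would contain a variable and, later, a derivative
  of it, which cannot be lower.\<close>

lemma wfp_less: "wfp (\<prec>)"
  unfolding wfp_def wf_iff_no_infinite_down_chain
proof
  assume "\<exists>f. \<forall>i. (f (Suc i), f i) \<in> {(x, y). x \<prec> y}"
  then obtain f where f: "\<And>i. f (Suc i) \<prec> f i" by auto
  have dec: "f j \<prec> f i" if "i < j" for i j
    using that f by (induction rule: strict_inc_induct) (auto intro: less_trans)
  obtain i j \<theta> where "i < j" "f j = apply_op \<theta> (f i)"
    using dickson_dvar[of f] by blast
  then have "(f i, f j) \<in> R" "f j \<prec> f i"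
    using rank_apply_op[of "f i" \<theta>] dec[of i j] by simp_all
  then show False using rank_antisym unfolding less_def by blast
qed

lemma finite_has_max:
  assumes "finite X" "X \<noteq> {}"
  shows "\<exists>u\<in>X. \<forall>v\<in>X. v = u \<or> v \<prec> u"
  using assms
proof (induction rule: finite_ne_induct)
  case (insert x F)
  then obtain u where u: "u \<in> F" "\<forall>v\<in>F. v = u \<or> v \<prec> u" by blast
  consider "x \<prec> u \<or> x = u" | "u \<prec> x" using less_linear[of x u] by argo
  then show ?case
  proof cases
    case 1
    with u(2) have "\<forall>v\<in>insert x F. v = u \<or> v \<prec> u" by (metis insert_iff)
    with u(1) show ?thesis by (intro bexI[of _ u]) simp_all
  next
    case 2
    with u(2) have "\<forall>v\<in>insert x F. v = x \<or> v \<prec> x" using less_trans[of _ u x] by auto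
    then show ?thesis by (intro bexI[of _ x]) simp_all
  qed
qed simp

text \<open>The definite description in \<open>leader\<close> is meaningful here: a nonempty finite
  set of variables has a maximum, which is unique by antisymmetry.\<close>

lemma leader_max:
  assumes "f \<notin> range dconst"
  shows "leader R f \<in> dvars f" "v \<in> dvars f \<Longrightarrow> v = leader R f \<or> v \<prec> leader R f"
proof -
  have "dvars f \<noteq> {}" using assms by (simp add: dvars_empty_iff)
  then obtain u where u: "u \<in> dvars f" "\<And>v. v \<in> dvars f \<Longrightarrow> v = u \<or> v \<prec> u"
    using finite_has_max[OF finite_dvars] by meson
  have leader: "leader R f = u"
    unfolding leader_def
  proof (rule the_equality)
    show "u \<in> dvars f \<and> (\<forall>v\<in>dvars f. (v, u) \<in> R)"
      using u unfolding less_def by (metis rank_refl)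
    show "u' = u" if "u' \<in> dvars f \<and> (\<forall>v\<in>dvars f. (v, u') \<in> R)" for u'
      using that u unfolding less_def by (metis rank_antisym)
  qed
  show "leader R f \<in> dvars f" unfolding leader by (rule u(1))
  show "v \<in> dvars f \<Longrightarrow> v = leader R f \<or> v \<prec> leader R f" unfolding leader by (rule u(2))
qed

lemma leader_deg_pos: "f \<notin> range dconst \<Longrightarrow> 0 < deg_in (leader R f) f"
  using leader_max(1) deg_in_eq_0_iff by (metis gr0I)

lemma deg_in_above_leader: "f \<notin> range dconst \<Longrightarrow> leader R f \<prec> w \<Longrightarrow> deg_in w f = 0"
  using leader_max(2)[of f w] less_trans[of w "leader R f" w] by (auto simp: deg_in_eq_0_iff)

end

subsection \<open>Ritt reduction\<close>

context ranked
begin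

text \<open>In the chain rule only the summand of \<open>v\<close> produces the derivative of
  \<open>v\<close>. The other variables of \<open>g\<close> lie below \<open>v\<close>, and a
  ranking keeps their derivatives below that of \<open>v\<close>.\<close>

lemma dext_leading:
  fixes g :: "('d, 'y, 'k::comm_ring_1) dpoly"
  assumes "\<And>w. v \<prec> w \<Longrightarrow> deg_in w g = 0"
  shows "\<exists>T. dext \<delta> i g = pderiv_in v g * dvar_poly (apply_op {#i#} v) + T \<and>
    (\<forall>w. w = apply_op {#i#} v \<or> apply_op {#i#} v \<prec> w \<longrightarrow> deg_in w T = 0)"
proof -
  let ?v = "apply_op {#i#} v"
  let ?t = "\<lambda>u. pderiv_in u g * dvar_poly (apply_op {#i#} u)"
  define C where "C = (\<Sum>m\<in>Poly_Mapping.keys g. Poly_Mapping.single m (\<delta> i (Poly_Mapping.lookup g m)))"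
  define T where "T = C + sum ?t (dvars g - {v})"
  \<comment> \<open>If \<open>v\<close> does not occur in \<open>g\<close>, its summand is zero, so
    it can be split off in either case.\<close>
  have "sum ?t (dvars g) = ?t v + sum ?t (dvars g - {v})"
  proof (cases "v \<in> dvars g")
    case True
    then show ?thesis by (simp add: sum.remove)
  next
    case False
    then show ?thesis by (simp add: pderiv_in_eq_0 deg_in_eq_0_iff)
  qed
  then have eq: "dext \<delta> i g = ?t v + T"
    by (simp add: dext_def T_def C_def algebra_simps)
  have "deg_in w T = 0" if w: "w = ?v \<or> ?v \<prec> w" for w
  proof -
    have "v \<prec> ?v" by (simp add: less_apply_op)
    with w have g0: "deg_in w g = 0" using assms[of w] less_trans[of v ?v w] by auto
    have "deg_in w C \<le> 0"
      unfolding C_def using g0 lookup_le_deg_in[of _ g w]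
      by (intro deg_in_sum_le deg_in_single_le) auto
    moreover have "deg_in w (?t u) \<le> 0" if u: "u \<in> dvars g - {v}" for u
    proof -
      have "u \<prec> v" using u assms[of u] less_linear[of u v] by (auto simp: deg_in_eq_0_iff)
      then have "apply_op {#i#} u \<prec> ?v" by (rule apply_op_mono)
      with w have "w \<noteq> apply_op {#i#} u" using less_trans[of w ?v w] by auto
      then have "deg_in w (dvar_poly (apply_op {#i#} u) :: ('d, 'y, 'k) dpoly) = 0"
        using deg_in_dvar_poly_le[of w "apply_op {#i#} u", where 'k = 'k] by simp
      moreover have "deg_in w (pderiv_in u g) = 0"
        using deg_in_pderiv_in_le[of w u g] g0 by simp
      ultimately show ?thesis
        using deg_in_mult_le[of w "pderiv_in u g" "dvar_poly (apply_op {#i#} u)"] by simp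
    qed
    ultimately have "deg_in w T \<le> 0"
      unfolding T_def by (intro deg_in_add_le deg_in_sum_le)
    then show ?thesis by simp
  qed
  with eq show ?thesis by (intro exI[of _ T]) simp
qed

text \<open>
  The third conjunct says that a proper derivative of \<open>b\<close> is linear in its leader, with the separant
  of \<open>b\<close> as initial. The first two, which hold for \<open>b\<close> itself as well, carry the induction.
\<close>

lemma derivative_in_ideal:
  fixes b :: "('d, 'y, 'k::comm_ring_1) dpoly"
  assumes "differential_ideal \<delta> K" "b \<in> K" "b \<notin> range dconst"
  shows "\<exists>g\<in>K. pderiv_in (apply_op \<theta> (leader R b)) g = separant R b \<and>
    (\<forall>w. apply_op \<theta> (leader R b) \<prec> w \<longrightarrow> deg_in w g = 0) \<and>
    (\<theta> \<noteq> {#} \<longrightarrow> (\<exists>T. g = separant R b * dvar_poly (apply_op \<theta> (leader R b)) + T \<and>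
      (\<forall>w. w = apply_op \<theta> (leader R b) \<or> apply_op \<theta> (leader R b) \<prec> w \<longrightarrow> deg_in w T = 0)))"
proof (induction \<theta>)
  case empty
  show ?case
    using assms(2) deg_in_above_leader[OF assms(3)] by (intro bexI[of _ b]) (simp_all add: separant_def)
next
  case (add i \<theta>)
  let ?u = "leader R b" and ?S = "separant R b"
  let ?v = "apply_op \<theta> ?u"
  let ?w = "apply_op (add_mset i \<theta>) ?u"
  have w: "apply_op {#i#} ?v = ?w" by (simp add: apply_op_apply_op)
  from add obtain g where g: "g \<in> K" "pderiv_in ?v g = ?S" "\<And>w. ?v \<prec> w \<Longrightarrow> deg_in w g = 0"
    by metis
  have ex: "\<exists>T. dext \<delta> i g = ?S * dvar_poly ?w + T \<and>
      (\<forall>w. w = ?w \<or> ?w \<prec> w \<longrightarrow> deg_in w T = 0)"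
    using dext_leading[where v = "?v" and \<delta> = \<delta> and i = i, OF g(3)] unfolding w g(2) .
  then obtain T where T: "dext \<delta> i g = ?S * dvar_poly ?w + T"
    "\<And>w. w = ?w \<or> ?w \<prec> w \<Longrightarrow> deg_in w T = 0"
    by blast
  \<comment> \<open>The separant involves only variables up to the leader of \<open>b\<close>, which
    lies strictly below the new variable \<open>?w\<close>.\<close>
  have uw: "?u \<prec> ?w" by (rule less_apply_op) simp
  have S0: "deg_in w ?S = 0" if "w = ?w \<or> ?w \<prec> w" for w
  proof -
    have "?u \<prec> w" using that uw less_trans[OF uw, of w] by (elim disjE) simp_all
    then have "deg_in w b = 0" by (rule deg_in_above_leader[OF assms(3)])
    then show ?thesis using deg_in_pderiv_in_le[of w ?u b] by (simp add: separant_def)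
  qed
  have "pderiv_in ?w (dext \<delta> i g) = ?S"
    unfolding T(1) by (rule pderiv_in_linear) (simp_all add: S0 T(2))
  moreover have "deg_in w (dext \<delta> i g) = 0" if "?w \<prec> w" for w
  proof -
    have "w \<noteq> ?w" using that by auto
    then have "deg_in w (dvar_poly ?w :: ('d, 'y, 'k) dpoly) = 0"
      using deg_in_dvar_poly_le[of w ?w, where 'k = 'k] by simp
    then have "deg_in w (?S * dvar_poly ?w) \<le> 0"
      using deg_in_mult_le[of w ?S "dvar_poly ?w"] S0 that by simp
    then have "deg_in w (dext \<delta> i g) \<le> 0"
      unfolding T(1) using T(2) that by (intro deg_in_add_le) simp_all
    then show ?thesis by simp
  qed
  moreover have "dext \<delta> i g \<in> K" using assms(1) g(1) by (rule differential_idealD(5))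
  moreover note ex
  ultimately show ?case by - (rule bexI, intro conjI impI allI)
qed

section \<open>Obstructions to being reduced and their removal\<close>

text \<open>The degree from which on a power of the derived leader can be cancelled: by
  \<open>b\<close> itself if the operator is trivial, otherwise by a proper derivative of
  \<open>b\<close>, which is linear in its leader.\<close>

definition threshold :: "'d dop \<Rightarrow> ('d, 'y, 'k::zero) dpoly \<Rightarrow> nat" where
  "threshold \<theta> b = (if \<theta> = {#} then deg_in (leader R b) b else 1)"

text \<open>This treats \<open>b\<close> and its proper derivatives uniformly as divisors:
  \<open>h\<close> is the initial of \<open>b\<close> in the first case and the separant in the
  second.\<close>

lemma reductor_in_ideal:
  fixes b :: "('d, 'y, 'k::comm_ring_1) dpoly"
  assumes "differential_ideal \<delta> K" "b \<in> K" "b \<notin> range dconst"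
    and "w = apply_op \<theta> (leader R b)" "e = threshold \<theta> b"
  obtains h T where "h * dvar_poly w ^ e + T \<in> K" "h \<in> {initial R b, separant R b}"
    "deg_in w T < e" "\<And>w'. w' = w \<or> w \<prec> w' \<Longrightarrow> deg_in w' h = 0" "\<And>w'. w \<prec> w' \<Longrightarrow> deg_in w' T = 0"
proof (cases "\<theta> = {#}")
  case True
  with assms(4,5) have w: "w = leader R b" and e: "deg_in w b = e" by (simp_all add: threshold_def)
  have "0 < e" using leader_deg_pos[OF assms(3)] e w by simp
  then obtain T where T: "b = coeff_in w e b * dvar_poly w ^ e + T" "deg_in w T < e"
      "\<And>w'. deg_in w' T \<le> deg_in w' b"
    using leading_coeff_split[OF e] by metis
  have b0: "deg_in w' b = 0" if "w \<prec> w'" for w'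
    using deg_in_above_leader[OF assms(3)] that w by simp
  show thesis
  proof (rule that)
    show "initial R b * dvar_poly w ^ e + T \<in> K"
      using T(1) assms(2) w e by (simp add: initial_def)
    show "deg_in w' (initial R b) = 0" if "w' = w \<or> w \<prec> w'" for w'
      using that b0[of w'] deg_in_coeff_in_le[of w' w e b] w e by (auto simp: initial_def)
    show "deg_in w' T = 0" if "w \<prec> w'" for w'
      using b0[OF that] T(3)[of w'] by simp
  qed (use T(2) in auto)
next
  case False
  obtain g where g: "g \<in> K" "\<exists>T. g = separant R b * dvar_poly w + T \<and>
      (\<forall>w'. w' = w \<or> w \<prec> w' \<longrightarrow> deg_in w' T = 0)"
    using derivative_in_ideal[OF assms(1-3), of \<theta>] False assms(4) by blast
  then obtain T where T: "g = separant R b * dvar_poly w + T"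
      "\<And>w'. w' = w \<or> w \<prec> w' \<Longrightarrow> deg_in w' T = 0"
    by blast
  have e: "e = 1" using assms(5) False by (simp add: threshold_def)
  show thesis
  proof (rule that)
    show "separant R b * dvar_poly w ^ e + T \<in> K"
      using T(1) g(1) e by simp
    show "deg_in w' (separant R b) = 0" if "w' = w \<or> w \<prec> w'" for w'
    proof -
      have "leader R b \<prec> w" using less_apply_op[OF False] assms(4) by simp
      then have "leader R b \<prec> w'" using that less_trans by blast
      then show ?thesis
        using deg_in_above_leader[OF assms(3)] deg_in_pderiv_in_le[of w' "leader R b" b]
        by (simp add: separant_def)
    qed
  qed (use T(2) e in auto)
qed

text \<open>These are the variables at which \<open>f\<close> fails to be reduced with respect to
  some element of \<open>B\<close>. Reduction terminates by descent on the highest of them and on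
  the degree of \<open>f\<close> in it.\<close>

definition obstructs :: "('d, 'y, 'k::zero) dpoly set \<Rightarrow> ('d, 'y, 'k) dpoly \<Rightarrow> ('d, 'y) dvar \<Rightarrow> bool" where
  "obstructs B f w \<longleftrightarrow> (\<exists>b\<in>B. \<exists>\<theta>. w = apply_op \<theta> (leader R b) \<and> threshold \<theta> b \<le> deg_in w f)"

lemma obstructs_mono: "obstructs B f w \<Longrightarrow> deg_in w f \<le> deg_in w f' \<Longrightarrow> obstructs B f' w"
  unfolding obstructs_def by (meson le_trans)

lemma reduced_if_no_obstruction:
  assumes "\<And>w. \<not> obstructs B f w" "b \<in> B"
  shows "reduced R f b"
  unfolding reduced_def
proof (intro conjI allI impI)
  have lt: "deg_in (apply_op \<theta> (leader R b)) f < threshold \<theta> b" for \<theta>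
    using assms(1)[of "apply_op \<theta> (leader R b)"] assms(2) unfolding obstructs_def not_le[symmetric]
    by blast
  show "apply_op \<theta> (leader R b) \<notin> dvars f" if "\<theta> \<noteq> {#}" for \<theta>
    using lt[of \<theta>] that by (simp add: threshold_def deg_in_eq_0_iff)
  show "deg_in (leader R b) f < deg_in (leader R b) b"
    using lt[of "{#}"] by (simp add: threshold_def)
qed

text \<open>Thresholds are positive because the elements of \<open>B\<close> are not constant. Hence
  only finitely many variables obstruct a given polynomial.\<close>

lemma obstructs_dvars:
  assumes "B \<inter> range dconst = {}" "obstructs B f w"
  shows "w \<in> dvars f"
proof -
  obtain b \<theta> where b: "b \<in> B" "threshold \<theta> b \<le> deg_in w f"
    using assms(2) unfolding obstructs_def by blast
  have "0 < deg_in (leader R b) b" using leader_deg_pos assms(1) b(1) by blast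
  then have "0 < threshold \<theta> b" by (simp add: threshold_def)
  with b(2) have "deg_in w f \<noteq> 0" by simp
  then show ?thesis by (simp add: deg_in_eq_0_iff)
qed

text \<open>One step of pseudo-division. Degrees in variables below \<open>v\<close> may grow, so
  nothing is claimed about them.\<close>

lemma reduction_step:
  fixes B K :: "('d, 'y, 'k::comm_ring_1) dpoly set"
  assumes "differential_ideal \<delta> K" "B \<subseteq> K" "B \<inter> range dconst = {}" "obstructs B f v"
  obtains b h f' where "b \<in> B" "h \<in> {initial R b, separant R b}" "h * f - f' \<in> K"
    "deg_in v f' < deg_in v f" "\<forall>w. v \<prec> w \<longrightarrow> deg_in w f' \<le> deg_in w f"
proof -
  obtain b \<theta> where b: "b \<in> B" "v = apply_op \<theta> (leader R b)" "threshold \<theta> b \<le> deg_in v f"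
    using assms(4) unfolding obstructs_def by blast
  define e where "e = threshold \<theta> b"
  define d where "d = deg_in v f"
  let ?x = "dvar_poly v :: ('d, 'y, 'k) dpoly"
  let ?c = "coeff_in v d f"
  have "b \<in> K" "b \<notin> range dconst" using assms(2,3) b(1) by auto
  then obtain h T where h: "h * ?x ^ e + T \<in> K" "h \<in> {initial R b, separant R b}" "deg_in v T < e"
      "\<And>w. w = v \<or> v \<prec> w \<Longrightarrow> deg_in w h = 0" "\<And>w. v \<prec> w \<Longrightarrow> deg_in w T = 0"
    using reductor_in_ideal[OF assms(1) _ _ b(2) e_def] by metis
  have "0 < d" using obstructs_dvars[OF assms(3,4)] by (auto simp: d_def deg_in_eq_0_iff intro: gr0I)
  then obtain F where F: "f = ?c * ?x ^ d + F" "deg_in v F < d" "\<And>w. deg_in w F \<le> deg_in w f"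
    using leading_coeff_split[OF d_def[symmetric]] by metis
  have ed: "e \<le> d" using b(3) by (simp add: e_def d_def)
  \<comment> \<open>Subtracting \<open>?c * ?x ^ (d - e)\<close> times the divisor
    \<open>h * ?x ^ e + T\<close> from \<open>h * f\<close> cancels the leading power of
    \<open>v\<close> and leaves exactly this.\<close>
  define f' where "f' = h * F - ?c * ?x ^ (d - e) * T"
  have "?x ^ d = ?x ^ (d - e) * ?x ^ e" using ed by (simp flip: power_add)
  then have "h * (?c * ?x ^ d + F) - f' = ?c * ?x ^ (d - e) * (h * ?x ^ e + T)"
    by (simp add: f'_def algebra_simps)
  then have "h * f - f' \<in> K"
    using differential_idealD(3)[OF assms(1) h(1)] F(1) by metis
  moreover have "deg_in v f' < d"
  proof -
    have "deg_in v (?x ^ (d - e)) \<le> d - e"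
      using deg_in_dvar_power_le[of v v "d - e", where 'k = 'k] by simp
    \<comment> \<open>In \<open>v\<close>, the factors have degree 0, at most \<open>d - e\<close>
      and at most \<open>e - 1\<close>.\<close>
    then have "deg_in v (?c * ?x ^ (d - e) * T) \<le> d - 1"
      using deg_in_mult_le[of v "?c * ?x ^ (d - e)" T] deg_in_mult_le[of v ?c "?x ^ (d - e)"] h(3) ed
      by simp
    moreover have "deg_in v (h * F) \<le> d - 1"
      using deg_in_mult_le[of v h F] h(4)[of v] F(2) by simp
    ultimately have "deg_in v f' \<le> d - 1"
      unfolding f'_def by (intro deg_in_diff_le)
    with \<open>0 < d\<close> show ?thesis by simp
  qed
  moreover have "deg_in w f' \<le> deg_in w f" if w: "v \<prec> w" for w
  proof -
    have "w \<noteq> v" using w by auto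
    then have "deg_in w (?x ^ (d - e)) = 0"
      using deg_in_dvar_power_le[of w v "d - e", where 'k = 'k] by simp
    then have "deg_in w (?c * ?x ^ (d - e) * T) \<le> deg_in w f"
      using deg_in_mult_le[of w "?c * ?x ^ (d - e)" T] deg_in_mult_le[of w ?c "?x ^ (d - e)"] h(5)[OF w]
        deg_in_coeff_in_le[of w v d f]
      by simp
    moreover have "deg_in w (h * F) \<le> deg_in w f"
      using deg_in_mult_le[of w h F] h(4)[of w] w F(3)[of w] by simp
    ultimately show ?thesis unfolding f'_def by (intro deg_in_diff_le)
  qed
  ultimately show thesis using that[OF b(1) h(2)] unfolding d_def by blast
qed

text \<open>
  The multiplier only divides a power of \<open>H\<^sub>\<B>\<close>: completing it to the full power would
  multiply the remainder by initials and separants, and the remainder would no longer be reduced.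
\<close>

lemma reduction_aux:
  fixes B K :: "('d, 'y, 'k::comm_ring_1) dpoly set"
  assumes "differential_ideal \<delta> K" "B \<subseteq> K" "B \<inter> range dconst = {}" "finite B"
    and "\<And>w. obstructs B f w \<Longrightarrow> w = v \<or> w \<prec> v"
  shows "\<exists>k s r. s dvd H_prod R B ^ k \<and> s * f - r \<in> K \<and> (\<forall>b\<in>B. reduced R r b)"
  using assms(5)
\<comment> \<open>The descent is lexicographic: the outer induction is on the bound \<open>v\<close>
  of the obstructing variables, the inner one on the degree in \<open>v\<close>.\<close>
proof (induction v arbitrary: f rule: wfp_induct_rule[OF wfp_less])
  case (1 v)
  from "1.prems" show ?case
  proof (induction "deg_in v f" arbitrary: f rule: less_induct)
    case (less f)
    show ?case
    proof (cases "obstructs B f v")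
      case True
      obtain b h f' where s: "b \<in> B" "h \<in> {initial R b, separant R b}" "h * f - f' \<in> K"
        "deg_in v f' < deg_in v f" "\<forall>w. v \<prec> w \<longrightarrow> deg_in w f' \<le> deg_in w f"
        by (rule reduction_step[OF assms(1-3) True])
      have below: "w = v \<or> w \<prec> v" if w: "obstructs B f' w" for w
      proof (rule ccontr)
        assume *: "\<not> (w = v \<or> w \<prec> v)"
        with less_linear[of v w] have "v \<prec> w" by metis
        then have "obstructs B f w" using obstructs_mono[OF w] s(5) by blast
        then show False using less.prems * by blast
      qed
      obtain k t r where
        t: "t dvd H_prod R B ^ k" "t * f' - r \<in> K" "\<forall>b\<in>B. reduced R r b"
        using less.hyps[OF s(4) below] by blast
      have "h dvd initial R b * separant R b" using s(2) by auto
      also have "\<dots> dvd H_prod R B"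
        unfolding H_prod_def using assms(4) s(1) by (rule dvd_prodI)
      finally have "t * h dvd H_prod R B ^ Suc k"
        using t(1) by (simp add: mult.commute mult_dvd_mono)
      moreover have "t * h * f - r \<in> K"
      proof -
        have "t * h * f - r = t * (h * f - f') + (t * f' - r)" by (simp add: algebra_simps)
        then show ?thesis by (metis differential_idealD(2,3)[OF assms(1)] s(3) t(2))
      qed
      ultimately show ?thesis using t(3) by blast
    next
      case no: False
      \<comment> \<open>If \<open>v\<close> itself does not obstruct, the highest obstructing
        variable is a strictly lower bound; if nothing obstructs, \<open>f\<close> is its own
        remainder with multiplier 1.\<close>
      show ?thesis
      proof (cases "\<exists>w. obstructs B f w")
        case True
        let ?V = "{w. obstructs B f w}"
        have "finite ?V"
          using obstructs_dvars[OF assms(3)] by (auto intro: finite_subset[OF _ finite_dvars[of f]])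
        moreover have "?V \<noteq> {}" using True by simp
        ultimately obtain u where u: "obstructs B f u" "\<And>w. obstructs B f w \<Longrightarrow> w = u \<or> w \<prec> u"
          using finite_has_max[of ?V] by blast
        have "u \<prec> v" using less.prems[OF u(1)] u(1) no by metis
        then show ?thesis using u(2) by (rule "1.IH")
      next
        case False
        then have "\<forall>b\<in>B. reduced R f b" using reduced_if_no_obstruction by blast
        moreover have "1 * f - f \<in> K" using differential_idealD(1)[OF assms(1)] by simp
        ultimately show ?thesis by (intro exI[of _ 0] exI[of _ 1] exI[of _ f]) simp
      qed
    qed
  qed
qed

theorem ritt_reduction:
  fixes B K :: "('d, 'y, 'k::comm_ring_1) dpoly set"
  assumes "differential_ideal \<delta> K" "B \<subseteq> K" "autoreduced R B"
  obtains k s r where "s dvd H_prod R B ^ k" "s * f - r \<in> K" "\<forall>b\<in>B. reduced R r b"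
proof -
  have B: "B \<inter> range dconst = {}" using assms(3) by (simp add: autoreduced_def)
  \<comment> \<open>The induction starts from the highest variable of \<open>f\<close>; if
    \<open>f\<close> is constant, nothing obstructs and any variable will do.\<close>
  have "\<exists>v. \<forall>w. obstructs B f w \<longrightarrow> w = v \<or> w \<prec> v"
  proof (cases "dvars f = {}")
    case True
    then show ?thesis using obstructs_dvars[OF B] by blast
  next
    case False
    then show ?thesis using finite_has_max[OF finite_dvars False] obstructs_dvars[OF B] by blast
  qed
  then show thesis
    using reduction_aux[OF assms(1,2) B autoreduced_finite[OF assms(3)]] that by metis
qed

end

subsection \<open>Characteristic sets\<close>

text \<open>Since \<open>P\<close> is inherited by smaller elements, it fails everywhere after its
  first failure.\<close>

lemma filter_eq_takeWhile_sorted_wrt: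
  assumes "sorted_wrt Q xs" "\<And>x y. Q x y \<Longrightarrow> P y \<Longrightarrow> P x"
  shows "filter P xs = takeWhile P xs"
  using assms(1)
proof (induction xs)
  case (Cons x xs)
  show ?case
  proof (cases "P x")
    case False
    then have "\<forall>y\<in>set xs. \<not> P y" using Cons.prems assms(2) by auto
    with False show ?thesis by (simp add: filter_empty_conv)
  qed (use Cons in simp)
qed simp

context ranked
begin

lemma rank_less_iff: "rank_less R p q \<longleftrightarrow> fst p \<prec> fst q \<or> fst p = fst q \<and> snd p < snd q"
  by (auto simp: rank_less_def less_def)

lemma rank_less_linear: "rank_less R p q \<or> p = q \<or> rank_less R q p"
  using less_linear[of "fst p" "fst q"] by (auto simp: rank_less_iff prod_eq_iff)

lemma rank_less_trans:
  assumes "rank_less R p q" "rank_less R q r"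
  shows "rank_less R p r"
  using assms less_trans[of "fst p" "fst q" "fst r"] unfolding rank_less_iff
  by (elim disjE conjE) simp_all

lemma reduced_cong_rank: "poly_rank R g = poly_rank R h \<Longrightarrow> reduced R f g \<longleftrightarrow> reduced R f h"
  by (auto simp: reduced_def poly_rank_def)

lemma reduced_poly_rank_neq: "reduced R f g \<Longrightarrow> poly_rank R f \<noteq> poly_rank R g"
  by (auto simp: reduced_def poly_rank_def)

lemma enumeration_insert:
  assumes "enumerates R as A" "poly_rank R r \<notin> poly_rank R ` A"
  shows "enumerates R (filter (\<lambda>f. rank_less R (poly_rank R f) (poly_rank R r)) as @ r #
    filter (\<lambda>f. rank_less R (poly_rank R r) (poly_rank R f)) as) (insert r A)"
proof -
  have "rank_less R (poly_rank R f) (poly_rank R r) \<or> rank_less R (poly_rank R r) (poly_rank R f)"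
    if "f \<in> A" for f
    using rank_less_linear[of "poly_rank R f" "poly_rank R r"] assms(2) that by (metis imageI)
  with assms show ?thesis
    unfolding enumerates_def
    by (auto simp: sorted_wrt_append sorted_wrt_filter intro: rank_less_trans)
qed

lemma enumeration_exists:
  assumes "finite A" "inj_on (poly_rank R) A"
  shows "\<exists>as. enumerates R as A"
  using assms
proof (induction A)
  case empty
  then show ?case by (simp add: enumerates_def)
next
  case (insert r A)
  then obtain as where "enumerates R as A" by (auto simp: inj_on_insert)
  moreover have "poly_rank R r \<notin> poly_rank R ` A" using insert by (auto simp: inj_on_insert)
  ultimately show ?case using enumeration_insert by blast
qed

text \<open>\<open>lower_rank\<close> asserts the existence of enumerations, so it compares two
  autoreduced sets properly only because each of them has one.\<close>

lemma autoreduced_enumeration: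
  assumes "autoreduced R A"
  shows "\<exists>as. enumerates R as A"
proof (rule enumeration_exists)
  show "inj_on (poly_rank R) A"
  proof (rule inj_onI, rule ccontr)
    fix f g assume "f \<in> A" "g \<in> A" "poly_rank R f = poly_rank R g" "f \<noteq> g"
    then show False using assms reduced_poly_rank_neq[of f g] by (simp add: autoreduced_def)
  qed
qed (rule autoreduced_finite[OF assms])

text \<open>Ranks are totally ordered, so if neither list is lower, a first position with different
  ranks cannot exist.\<close>

lemma same_ranks:
  assumes "autoreduced R A" "autoreduced R B" "\<not> lower_rank R A B" "\<not> lower_rank R B A"
  shows "poly_rank R ` A = poly_rank R ` B"
proof -
  obtain as bs where enum: "enumerates R as A" "enumerates R bs B"
    using autoreduced_enumeration assms(1,2) by metis
  have nab: "\<not> list_lower_rank R as bs" and nba: "\<not> list_lower_rank R bs as"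
    using assms(3,4) enum unfolding lower_rank_def by blast+
  have eq: "poly_rank R (as ! i) = poly_rank R (bs ! i)" if "i < length as" "i < length bs" for i
    using that
  proof (induction i rule: less_induct)
    case (less i)
    then have below: "\<forall>j<i. poly_rank R (as ! j) = poly_rank R (bs ! j)" by simp
    have "\<not> rank_less R (poly_rank R (as ! i)) (poly_rank R (bs ! i))"
      using nab below less.prems unfolding list_lower_rank_def by blast
    moreover have "\<not> rank_less R (poly_rank R (bs ! i)) (poly_rank R (as ! i))"
      using nba below[THEN spec, THEN mp, symmetric] less.prems unfolding list_lower_rank_def by blast
    ultimately show ?case
      using rank_less_linear[of "poly_rank R (as ! i)" "poly_rank R (bs ! i)"] by simp
  qed
  \<comment> \<open>With equal ranks at the common positions, a longer list would be a lower
    one.\<close>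
  have "\<not> length bs < length as"
    using nab eq order.strict_trans unfolding list_lower_rank_def by blast
  moreover have "\<not> length as < length bs"
    using nba eq[symmetric] order.strict_trans unfolding list_lower_rank_def by blast
  ultimately have "length as = length bs" by simp
  then have "map (poly_rank R) as = map (poly_rank R) bs"
    by (intro nth_equalityI) (simp_all add: eq)
  then have "poly_rank R ` set as = poly_rank R ` set bs" by (metis set_map)
  with enum show ?thesis by (simp add: enumerates_def)
qed

text \<open>If \<open>r\<close> were reduced with respect to all of \<open>A\<close>, then keeping
  the elements of lower rank than \<open>r\<close>, appending \<open>r\<close> and dropping the rest
  would give an autoreduced set of lower rank.\<close>

lemma characteristic_set_no_reduced:
  fixes A K :: "('d, 'y, 'k::zero) dpoly set"
  assumes "characteristic_set R A K" "r \<in> K" "r \<notin> range dconst"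
  shows "\<exists>a\<in>A. \<not> reduced R r a"
proof (rule ccontr)
  assume "\<not> (\<exists>a\<in>A. \<not> reduced R r a)"
  then have red: "\<And>a. a \<in> A \<Longrightarrow> reduced R r a" by blast
  have auto: "autoreduced R A" and "A \<subseteq> K"
    and min: "\<And>B. autoreduced R B \<Longrightarrow> B \<subseteq> K \<Longrightarrow> \<not> lower_rank R B A"
    using assms(1) by (auto simp: characteristic_set_def)
  obtain as where as: "enumerates R as A" using autoreduced_enumeration[OF auto] by blast
  define P :: "('d, 'y, 'k) dpoly \<Rightarrow> bool" where "P f \<longleftrightarrow> rank_less R (poly_rank R f) (poly_rank R r)" for f
  define bs where "bs = takeWhile P as @ [r]"
  define n where "n = length (takeWhile P as)"
  \<comment> \<open>\<open>filter\<close> gives control of the underlying set,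
    \<open>takeWhile\<close> of the positions.\<close>
  have filter: "filter P as = takeWhile P as"
    using as unfolding enumerates_def P_def
    by (intro filter_eq_takeWhile_sorted_wrt[of "\<lambda>f g. rank_less R (poly_rank R f) (poly_rank R g)"])
      (auto intro: rank_less_trans)
  have set_bs: "set bs = insert r {a \<in> A. P a}"
    using as unfolding bs_def filter[symmetric] enumerates_def by auto
  have "enumerates R bs (set bs)"
    using as unfolding bs_def filter[symmetric] enumerates_def
    by (auto simp: sorted_wrt_append sorted_wrt_filter P_def)
  moreover have "autoreduced R (set bs)"
  proof -
    \<comment> \<open>Reducedness in this direction comes from the ranks: proper derivatives of the
      leader of \<open>r\<close> lie above every variable of \<open>a\<close>.\<close>
    have "reduced R a r" if "a \<in> A" "P a" for a
    proof -
      have a: "a \<notin> range dconst" using that(1) auto by (auto simp: autoreduced_def)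
      have le: "leader R a \<prec> leader R r \<or> leader R a = leader R r \<and> deg_in (leader R a) a < deg_in (leader R r) r"
        using that(2) by (simp add: P_def rank_less_iff poly_rank_def)
      have "apply_op \<theta> (leader R r) \<notin> dvars a" if "\<theta> \<noteq> {#}" for \<theta>
      proof -
        have "leader R a \<prec> apply_op \<theta> (leader R r)"
          using le less_apply_op[OF that, of "leader R r"]
            less_trans[of "leader R a" "leader R r" "apply_op \<theta> (leader R r)"] by auto
        then have "deg_in (apply_op \<theta> (leader R r)) a = 0" by (rule deg_in_above_leader[OF a])
        then show ?thesis by (simp add: deg_in_eq_0_iff)
      qed
      moreover have "deg_in (leader R r) a < deg_in (leader R r) r"
        using le deg_in_above_leader[OF a, of "leader R r"] leader_deg_pos[OF assms(3)] by auto
      ultimately show ?thesis by (simp add: reduced_def)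
    qed
    then show ?thesis
      using auto red assms(3) unfolding set_bs autoreduced_def by blast
  qed
  moreover have "set bs \<subseteq> K" using \<open>A \<subseteq> K\<close> assms(2) by (auto simp: set_bs)
  moreover have "list_lower_rank R bs as"
  proof -
    have len: "length bs = Suc n" and r: "bs ! n = r" by (simp_all add: bs_def n_def)
    have eq: "bs ! i = as ! i" if "i < n" for i
      using that by (simp add: bs_def n_def nth_append takeWhile_nth)
    show ?thesis
    \<comment> \<open>Either \<open>r\<close> stands against an element of higher rank at position
      \<open>n\<close>, or \<open>bs\<close> prolongs all of \<open>as\<close> by \<open>r\<close>
      and is lower for being longer.\<close>
    proof (cases "n < length as")
      case True
      then have "\<not> P (as ! n)" unfolding n_def by (rule nth_length_takeWhile)
      moreover have "as ! n \<in> A" using True as by (auto simp: enumerates_def)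
      ultimately have "rank_less R (poly_rank R (bs ! n)) (poly_rank R (as ! n))"
        using rank_less_linear[of "poly_rank R (as ! n)" "poly_rank R r"]
          reduced_poly_rank_neq[OF red, of "as ! n"] unfolding r P_def by metis
      with True len eq have "n < length bs \<and> n < length as \<and>
          (\<forall>i<n. poly_rank R (bs ! i) = poly_rank R (as ! i)) \<and>
          rank_less R (poly_rank R (bs ! n)) (poly_rank R (as ! n))"
        by simp
      then show ?thesis unfolding list_lower_rank_def by blast
    next
      case False
      moreover have "n \<le> length as" by (simp add: n_def length_takeWhile_le)
      ultimately have "n = length as" by simp
      with len eq show ?thesis by (simp add: list_lower_rank_def)
    qed
  qed
  ultimately show False using min[of "set bs"] as by (auto simp: lower_rank_def)
qed

text \<open>One of the two inclusions; the other arises by exchanging roles. The condition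
  \<open>H_prod R B \<notin> I\<close> serves to keep nonzero constants out of
  \<open>I\<close>.\<close>

lemma characterizable_subset:
  fixes A B I J :: "('d, 'y, 'k::field) dpoly set"
  assumes "differential_ideal \<delta> I" "characteristic_set R A I" "autoreduced R B"
    and "J = saturation (differential_ideal_gen \<delta> B) (H_prod R B)"
    and "poly_rank R ` A = poly_rank R ` B" "B \<subseteq> I" "H_prod R B \<notin> I"
  shows "I \<subseteq> J"
proof
  fix f assume f: "f \<in> I"
  let ?G = "differential_ideal_gen \<delta> B"
  note G = differential_ideal_gen_ideal[of \<delta> B] and I = differential_idealD[OF assms(1)]
  obtain k s r where r: "s dvd H_prod R B ^ k" "s * f - r \<in> ?G" "\<forall>b\<in>B. reduced R r b"
    by (rule ritt_reduction[OF G differential_ideal_gen_superset assms(3)])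
  have "?G \<subseteq> I" using assms(1,6) by (rule differential_ideal_gen_minimal)
  then have "s * f - r \<in> I" using r(2) by (rule subsetD)
  then have "s * f - (s * f - r) \<in> I" by (rule I(4)[OF I(3)[OF f]])
  then have rI: "r \<in> I" by simp
  \<comment> \<open>Being reduced with respect to a polynomial depends only on the rank of that
    polynomial.\<close>
  have "reduced R r a" if "a \<in> A" for a
  proof -
    have "poly_rank R a \<in> poly_rank R ` B" using that assms(5) by blast
    then obtain b where "b \<in> B" "poly_rank R a = poly_rank R b" by (rule imageE)
    then show ?thesis using r(3) reduced_cong_rank[of a b r] by simp
  qed
  then obtain c where c: "r = dconst c"
    using characteristic_set_no_reduced[OF assms(2) rI] by blast
  \<comment> \<open>A nonzero constant is invertible, so \<open>I\<close> would contain every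
    polynomial, in particular \<open>H_prod R B\<close>.\<close>
  have "c = 0"
  proof (rule ccontr)
    assume "c \<noteq> 0"
    then have "H_prod R B = H_prod R B * dconst (inverse c) * r"
      by (simp add: c dconst_def mult_single mult.assoc)
    moreover have "H_prod R B * dconst (inverse c) * r \<in> I" by (rule I(3)[OF rI])
    ultimately show False using assms(7) by simp
  qed
  then have "s * f \<in> ?G" using r(2) c by (simp add: dconst_def)
  \<comment> \<open>The multiplier may now be completed to the full power, since the remainder is
    already zero.\<close>
  moreover obtain t where "H_prod R B ^ k = s * t" using r(1) by (rule dvdE)
  ultimately have "H_prod R B ^ k * f \<in> ?G"
    using differential_idealD(3)[OF G, of "s * f" t] by (simp add: ac_simps)
  then show "f \<in> J" using assms(4) by (auto simp: saturation_def)
qed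

end

subsection \<open>Evaluation at a differential point of the field\<close>

definition eval_monom :: "(('d, 'y) dvar \<Rightarrow> 'k::comm_ring_1) \<Rightarrow> ('d, 'y) dmonom \<Rightarrow> 'k" where
  "eval_monom x m = (\<Prod>u\<in>Poly_Mapping.keys m. x u ^ Poly_Mapping.lookup m u)"

definition eval_poly :: "(('d, 'y) dvar \<Rightarrow> 'k::comm_ring_1) \<Rightarrow> ('d, 'y, 'k) dpoly \<Rightarrow> 'k" where
  "eval_poly x f = (\<Sum>m\<in>Poly_Mapping.keys f. Poly_Mapping.lookup f m * eval_monom x m)"

text \<open>Padding with exponents 0 allows monomials of different supports to be evaluated over a
  common set.\<close>

lemma eval_monom_superset:
  assumes "finite S" "Poly_Mapping.keys m \<subseteq> S"
  shows "eval_monom x m = (\<Prod>u\<in>S. x u ^ Poly_Mapping.lookup m u)"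
  unfolding eval_monom_def
  by (rule prod.mono_neutral_left) (use assms in \<open>auto simp: in_keys_iff\<close>)

lemma eval_monom_add: "eval_monom x (m + n) = eval_monom x m * eval_monom x n"
proof -
  let ?S = "Poly_Mapping.keys m \<union> Poly_Mapping.keys n"
  have "eval_monom x (m + n) = (\<Prod>u\<in>?S. x u ^ Poly_Mapping.lookup (m + n) u)"
    by (rule eval_monom_superset) (auto dest: subsetD[OF keys_add])
  also have "\<dots> = (\<Prod>u\<in>?S. x u ^ Poly_Mapping.lookup m u) * (\<Prod>u\<in>?S. x u ^ Poly_Mapping.lookup n u)"
    by (simp add: lookup_add power_add prod.distrib)
  also have "\<dots> = eval_monom x m * eval_monom x n"
    by (simp add: eval_monom_superset[where S = ?S])
  finally show ?thesis .
qed

lemma eval_poly_single: "eval_poly x (Poly_Mapping.single m c) = c * eval_monom x m"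
  by (simp add: eval_poly_def)

lemma eval_poly_dconst [simp]: "eval_poly x (dconst c) = c"
  by (simp add: dconst_def eval_poly_single eval_monom_def)

lemma eval_poly_dvar_poly [simp]: "eval_poly x (dvar_poly u) = x u"
  by (simp add: dvar_poly_def eval_poly_single eval_monom_def)

lemma eval_poly_zero [simp]: "eval_poly x 0 = 0"
  by (simp add: eval_poly_def)

lemma eval_poly_one [simp]: "eval_poly x 1 = 1"
  by (simp add: eval_poly_def eval_monom_def)

lemma eval_poly_add: "eval_poly x (f + g) = eval_poly x f + eval_poly x g"
  unfolding eval_poly_def by (rule setsum_keys_plus_distrib) (simp_all add: distrib_right)

lemma eval_poly_sum: "eval_poly x (sum f X) = (\<Sum>i\<in>X. eval_poly x (f i))"
  by (induction X rule: infinite_finite_induct) (simp_all add: eval_poly_add)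

lemma eval_poly_mult: "eval_poly x (f * g) = eval_poly x f * eval_poly x g"
proof -
  let ?s = "\<lambda>f m. Poly_Mapping.single m (Poly_Mapping.lookup f m)"
  have "eval_poly x (sum (?s f) (Poly_Mapping.keys f) * sum (?s g) (Poly_Mapping.keys g)) =
      eval_poly x f * eval_poly x g"
    by (simp add: sum_product mult_single eval_poly_sum eval_poly_single eval_monom_add
        eval_poly_def[of x f] eval_poly_def[of x g] ac_simps)
  then show ?thesis unfolding sum_single_lookup .
qed

lemma eval_poly_power: "eval_poly x (f ^ n) = eval_poly x f ^ n"
  by (induction n) (simp_all add: eval_poly_mult)

lemma eval_poly_prod: "eval_poly x (prod f X) = (\<Prod>i\<in>X. eval_poly x (f i))"
  by (induction X rule: infinite_finite_induct) (simp_all add: eval_poly_mult)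

section \<open>Leibniz rules for a derivation\<close>

context
  fixes D :: "'a::comm_ring_1 \<Rightarrow> 'a"
  assumes D: "derivation D"
begin

lemma derivation_add: "D (x + y) = D x + D y"
  and derivation_mult: "D (x * y) = D x * y + x * D y"
  using D by (simp_all add: derivation_def)

lemma derivation_zero: "D 0 = 0"
  using derivation_add[of 0 0] by simp

lemma derivation_one: "D 1 = 0"
  using derivation_mult[of 1 1] by simp

lemma derivation_sum: "D (sum f X) = (\<Sum>i\<in>X. D (f i))"
  by (induction X rule: infinite_finite_induct) (simp_all add: derivation_add derivation_zero)

text \<open>For \<open>n = 0\<close> the truncated exponent is harmless, because the factor
  \<open>of_nat n\<close> vanishes.\<close>

lemma derivation_power: "D (x ^ n) = of_nat n * x ^ (n - 1) * D x"
proof (induction n)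
  case (Suc n)
  then show ?case
    by (cases n) (simp_all add: derivation_mult algebra_simps)
qed (simp add: derivation_one)

lemma derivation_prod:
  "finite X \<Longrightarrow> D (prod f X) = (\<Sum>i\<in>X. D (f i) * prod f (X - {i}))"
proof (induction X rule: finite_induct)
  case (insert i X)
  have "prod f (insert i X - {j}) = f i * prod f (X - {j})" if "j \<in> X" for j
  proof -
    have "insert i X - {j} = insert i (X - {j})" using insert(2) that by auto
    then show ?thesis using insert(1,2) by simp
  qed
  then have "(\<Sum>j\<in>X. D (f j) * prod f (insert i X - {j})) = f i * (\<Sum>j\<in>X. D (f j) * prod f (X - {j}))"
    by (simp add: sum_distrib_left mult.left_commute)
  moreover have "insert i X - {i} = X" using insert(2) by simp
  ultimately show ?case
    using insert by (simp add: derivation_mult)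
qed (simp add: derivation_one)

text \<open>The Leibniz rule over the support of \<open>m\<close>; exponents there are positive, so
  the truncated subtraction is exact.\<close>

lemma derivation_eval_monom:
  "D (eval_monom x m) =
    (\<Sum>u\<in>Poly_Mapping.keys m. of_nat (Poly_Mapping.lookup m u) *
      eval_monom x (m - Poly_Mapping.single u 1) * D (x u))"
proof -
  let ?K = "Poly_Mapping.keys m"
  let ?p = "\<lambda>u. x u ^ Poly_Mapping.lookup m u"
  have "eval_monom x (m - Poly_Mapping.single u 1) =
      x u ^ (Poly_Mapping.lookup m u - 1) * prod ?p (?K - {u})" if "u \<in> ?K" for u
  proof -
    have "eval_monom x (m - Poly_Mapping.single u 1) =
        (\<Prod>v\<in>?K. x v ^ Poly_Mapping.lookup (m - Poly_Mapping.single u 1) v)"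
      by (rule eval_monom_superset) (auto simp: in_keys_iff lookup_minus)
    also have "\<dots> = x u ^ (Poly_Mapping.lookup m u - 1) *
        (\<Prod>v\<in>?K - {u}. x v ^ Poly_Mapping.lookup (m - Poly_Mapping.single u 1) v)"
      using that by (simp add: prod.remove[of ?K u] lookup_minus)
    also have "(\<Prod>v\<in>?K - {u}. x v ^ Poly_Mapping.lookup (m - Poly_Mapping.single u 1) v) =
        prod ?p (?K - {u})"
      by (rule prod.cong) (auto simp: lookup_minus lookup_single when_def)
    finally show ?thesis .
  qed
  then show ?thesis
    unfolding eval_monom_def[of x m]
    by (subst derivation_prod) (auto simp: derivation_power ac_simps intro!: sum.cong)
qed

end

text \<open>The value of \<open>\<theta> y\<^sub>j\<close> is \<open>\<theta> (c j)\<close>, so that evaluation commutes with the derivations.\<close>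

definition point :: "('d \<Rightarrow> 'k \<Rightarrow> 'k) \<Rightarrow> ('y \<Rightarrow> 'k) \<Rightarrow> ('d, 'y) dvar \<Rightarrow> 'k" where
  "point \<delta> c u = fold_mset \<delta> (c (snd u)) (fst u)"

text \<open>Because the derivations commute, the fold over a multiset does not depend on the order,
  and the new operator can be applied last.\<close>

lemma point_apply_op:
  assumes "differential_field \<delta>"
  shows "point \<delta> c (apply_op {#i#} u) = \<delta> i (point \<delta> c u)"
proof -
  interpret comp_fun_commute \<delta>
    using assms by unfold_locales (auto simp: differential_field_def fun_eq_iff)
  show ?thesis by (simp add: point_def apply_op_def)
qed

text \<open>The coefficient part and the chain rule part of \<open>dext\<close> match the two terms
  of the Leibniz rule for coefficient times monomial, once the sums over variables and monomials are
  exchanged.\<close>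

lemma eval_poly_dext:
  assumes "differential_field \<delta>"
  shows "eval_poly (point \<delta> c) (dext \<delta> i f) = \<delta> i (eval_poly (point \<delta> c) f)"
proof -
  let ?x = "point \<delta> c" and ?D = "\<delta> i" and ?K = "Poly_Mapping.keys f"
  let ?l = "Poly_Mapping.lookup"
  have D: "derivation ?D" using assms by (simp add: differential_field_def)
  define g where "g m u = of_nat (?l m u) * eval_monom ?x (m - Poly_Mapping.single u 1) * ?D (?x u)" for m u
  have "eval_poly ?x (pderiv_in u f * dvar_poly (apply_op {#i#} u)) = (\<Sum>m\<in>?K. ?l f m * g m u)" for u
    by (simp add: pderiv_in_def eval_poly_mult eval_poly_sum eval_poly_single g_def
        point_apply_op[OF assms] sum_distrib_right sum_distrib_left ac_simps)
  then have "eval_poly ?x (dext \<delta> i f) =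
      (\<Sum>m\<in>?K. ?D (?l f m) * eval_monom ?x m) + (\<Sum>u\<in>dvars f. \<Sum>m\<in>?K. ?l f m * g m u)"
    by (simp add: dext_def eval_poly_add eval_poly_sum eval_poly_single)
  also have "(\<Sum>u\<in>dvars f. \<Sum>m\<in>?K. ?l f m * g m u) = (\<Sum>m\<in>?K. \<Sum>u\<in>dvars f. ?l f m * g m u)"
    by (rule sum.swap)
  also have "\<dots> = (\<Sum>m\<in>?K. ?l f m * ?D (eval_monom ?x m))"
  proof (rule sum.cong)
    fix m assume "m \<in> ?K"
    \<comment> \<open>Variables of \<open>f\<close> outside \<open>m\<close> have exponent 0 in
      \<open>m\<close> and contribute nothing.\<close>
    then have "(\<Sum>u\<in>dvars f. g m u) = (\<Sum>u\<in>Poly_Mapping.keys m. g m u)"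
      by (intro sum.mono_neutral_right) (auto simp: dvars_def g_def in_keys_iff)
    then show "(\<Sum>u\<in>dvars f. ?l f m * g m u) = ?l f m * ?D (eval_monom ?x m)"
      by (simp add: derivation_eval_monom[OF D] g_def flip: sum_distrib_left)
  qed simp
  also have "(\<Sum>m\<in>?K. ?D (?l f m) * eval_monom ?x m) + \<dots> = ?D (eval_poly ?x f)"
    by (simp add: eval_poly_def derivation_sum[OF D] derivation_mult[OF D] sum.distrib)
  finally show ?thesis .
qed

text \<open>As a differential ideal, this kernel contains \<open>[A]\<close> as soon as it contains
  \<open>A\<close>.\<close>

lemma eval_kernel_ideal:
  assumes "differential_field \<delta>"
  shows "differential_ideal \<delta> {f. eval_poly (point \<delta> c) f = 0}"
proof -
  have "\<delta> i 0 = 0" for i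
    using assms derivation_zero by (auto simp: differential_field_def)
  then show ?thesis
    by (simp add: differential_ideal_def ideal_iff eval_poly_add eval_poly_mult
        eval_poly_dext[OF assms])
qed

subsection \<open>The unit ideal\<close>

context ranked
begin

text \<open>Autoreduced sets contain no constants, so even here \<open>A\<close> consists of
  nonconstant polynomials. Testing minimality on the indeterminates determines their shape.\<close>

lemma characteristic_set_UNIV:
  fixes A :: "('d, 'y, 'k::field) dpoly set"
  assumes "characteristic_set R A UNIV"
  shows "\<exists>a \<alpha> \<beta>. A = range a \<and> (\<forall>j. \<alpha> j \<noteq> 0 \<and> a j = dconst (\<alpha> j) * dvar_poly ({#}, j) + dconst (\<beta> j) \<and>
    initial R (a j) = dconst (\<alpha> j) \<and> separant R (a j) = dconst (\<alpha> j))"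
proof -
  have auto: "autoreduced R A" using assms by (simp add: characteristic_set_def)
  have nc: "f \<notin> range dconst" if "f \<in> A" for f
    using auto that by (auto simp: autoreduced_def)
  have red: "reduced R f g" if "f \<in> A" "g \<in> A" "f \<noteq> g" for f g
    using auto that by (simp add: autoreduced_def)
  \<comment> \<open>The indeterminate lies in the unit ideal, so it is not reduced with respect to
    some \<open>f\<close> in \<open>A\<close>; being linear in a single variable, it forces the
    leader and degree of \<open>f\<close>.\<close>
  have "\<exists>f\<in>A. leader R f = ({#}, j) \<and> deg_in ({#}, j) f = 1" for j
  proof -
    let ?y = "dvar_poly ({#}, j) :: ('d, 'y, 'k) dpoly"
    have dv: "dvars ?y = {({#}, j)}" by (simp add: dvars_def dvar_poly_def)
    then have "?y \<notin> range dconst" using dvars_empty_iff[of ?y] by simp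
    then obtain f where f: "f \<in> A" "\<not> reduced R ?y f"
      using characteristic_set_no_reduced[OF assms] by blast
    have pos: "0 < deg_in (leader R f) f" using leader_deg_pos[OF nc[OF f(1)]] .
    have "deg_in (leader R f) f \<le> deg_in (leader R f) ?y"
    proof -
      have "apply_op \<theta> (leader R f) \<notin> dvars ?y" if "\<theta> \<noteq> {#}" for \<theta>
        using that unfolding dv by (simp add: apply_op_def prod_eq_iff)
      then show ?thesis using f(2) by (simp add: reduced_def not_less)
    qed
    with pos deg_in_dvar_poly_le[of "leader R f" "({#}, j)", where 'k = 'k]
    have "leader R f = ({#}, j)" "deg_in (leader R f) f = 1"
      by (auto split: if_splits)
    with f(1) show ?thesis by auto
  qed
  then obtain a where a: "\<And>j. a j \<in> A" "\<And>j. leader R (a j) = ({#}, j)" "\<And>j. deg_in ({#}, j) (a j) = 1"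
    by metis
  \<comment> \<open>Any further element would contain no derivative of any indeterminate with an
    \<open>a j\<close>, hence not even its own leader.\<close>
  have "f \<in> range a" if "f \<in> A" for f
  proof (rule ccontr)
    obtain \<theta> j where u: "leader R f = (\<theta>, j)" by (cases "leader R f")
    assume "f \<notin> range a"
    then have "reduced R f (a j)" using red[OF that a(1)] by blast
    then have "\<eta> \<noteq> {#} \<Longrightarrow> (\<eta>, j) \<notin> dvars f" "deg_in ({#}, j) f = 0" for \<eta>
      by (auto simp: reduced_def a apply_op_def)
    then have "leader R f \<notin> dvars f" unfolding u by (cases "\<theta> = {#}") (simp_all add: deg_in_eq_0_iff)
    then show False using leader_max(1)[OF nc[OF that]] by simp
  qed
  then have A: "A = range a" using a(1) by auto
  have dvars_a: "dvars (a j) = {({#}, j)}" for j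
  proof -
    \<comment> \<open>Proper derivatives of the indeterminate \<open>j\<close> lie above the leader
      of \<open>a j\<close>; all derivatives of another \<open>i\<close> are excluded by reducedness
      with respect to \<open>a i\<close>.\<close>
    have "v = ({#}, j)" if v: "v \<in> dvars (a j)" for v
    proof (rule ccontr)
      assume neq: "v \<noteq> ({#}, j)"
      obtain \<theta> i where vi: "v = (\<theta>, i)" by (cases v)
      show False
      proof (cases "i = j")
        case True
        then have "v = apply_op \<theta> ({#}, j)" "\<theta> \<noteq> {#}" using vi neq by (auto simp: apply_op_def)
        then have "leader R (a j) \<prec> v" using less_apply_op a(2) by simp
        then show False using deg_in_above_leader[OF nc[OF a(1)]] v by (simp add: deg_in_eq_0_iff)
      next
        case False
        then have "a j \<noteq> a i" using a(2) by (metis prod.inject)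
        then have "reduced R (a j) (a i)" by (intro red a(1))
        then have "v \<notin> dvars (a j)"
          unfolding vi by (cases "\<theta> = {#}") (auto simp: reduced_def a apply_op_def deg_in_eq_0_iff)
        with v show False by simp
      qed
    qed
    moreover have "({#}, j) \<in> dvars (a j)" using leader_max(1)[OF nc[OF a(1)]] a(2) by metis
    ultimately show ?thesis by blast
  qed
  have "\<exists>\<alpha> \<beta>. \<alpha> \<noteq> 0 \<and> a j = dconst \<alpha> * dvar_poly ({#}, j) + dconst \<beta> \<and>
    initial R (a j) = dconst \<alpha> \<and> separant R (a j) = dconst \<alpha>" for j
  proof -
    let ?u = "({#}, j) :: ('d, 'y) dvar"
    let ?C = "coeff_in ?u 1 (a j)"
    obtain T where T: "a j = ?C * dvar_poly ?u ^ 1 + T" "deg_in ?u T < 1"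
      "\<And>w. deg_in w T \<le> deg_in w (a j)"
      using leading_coeff_split[OF a(3)] zero_less_one by metis
    have other: "deg_in w (a j) = 0" if "w \<noteq> ?u" for w
      using that by (simp add: deg_in_eq_0_iff dvars_a)
    have C0: "deg_in w ?C = 0" for w
      using deg_in_coeff_in_le[of w ?u 1 "a j"] other[of w] by (cases "w = ?u") simp_all
    have T0: "deg_in w T = 0" for w
      using T(2) T(3)[of w] other[of w] by (cases "w = ?u") simp_all
    have "dvars ?C = {}" "dvars T = {}" using C0 T0 by (auto simp: deg_in_eq_0_iff)
    then obtain \<alpha> \<beta> where \<alpha>: "?C = dconst \<alpha>" and \<beta>: "T = dconst \<beta>"
      unfolding dvars_empty_iff by blast
    have eq: "a j = dconst \<alpha> * dvar_poly ?u + dconst \<beta>" using T(1) \<alpha> \<beta> by simp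
    have "\<alpha> \<noteq> 0"
    proof
      assume "\<alpha> = 0"
      then have "a j = dconst \<beta>" unfolding eq by (simp add: dconst_def)
      then show False using nc[OF a(1)] by blast
    qed
    moreover have "initial R (a j) = dconst \<alpha>" using \<alpha> by (simp add: initial_def a)
    moreover have "separant R (a j) = dconst \<alpha>"
      unfolding separant_def a(2)
      by (subst eq) (use C0 T0 \<alpha> \<beta> in \<open>auto intro: pderiv_in_linear\<close>)
    ultimately show ?thesis using eq by blast
  qed
  then show ?thesis using A by metis
qed

text \<open>Evaluation at a common differential zero of \<open>A\<close> annihilates
  \<open>[A]\<close> but no power of \<open>H_prod R A\<close>.\<close>

lemma unit_ideal_not_saturated:
  fixes A :: "('d, 'y, 'k::field) dpoly set"
  assumes "differential_field \<delta>" "characteristic_set R A UNIV"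
  shows "1 \<notin> saturation (differential_ideal_gen \<delta> A) (H_prod R A)"
proof
  assume "1 \<in> saturation (differential_ideal_gen \<delta> A) (H_prod R A)"
  then obtain n where n: "H_prod R A ^ n \<in> differential_ideal_gen \<delta> A"
    by (auto simp: saturation_def)
  obtain a \<alpha> \<beta> where A: "A = range a" and "\<forall>j. \<alpha> j \<noteq> 0 \<and>
    a j = dconst (\<alpha> j) * dvar_poly ({#}, j) + dconst (\<beta> j) \<and>
    initial R (a j) = dconst (\<alpha> j) \<and> separant R (a j) = dconst (\<alpha> j)"
    using characteristic_set_UNIV[OF assms(2)] by (elim exE conjE)
  then have a: "\<alpha> j \<noteq> 0" "a j = dconst (\<alpha> j) * dvar_poly ({#}, j) + dconst (\<beta> j)"
    "initial R (a j) = dconst (\<alpha> j)" "separant R (a j) = dconst (\<alpha> j)" for j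
    by blast+
  \<comment> \<open>The root of each linear polynomial \<open>a j\<close>, prolonged to all
    derivatives by \<open>point\<close>.\<close>
  define x where "x = point \<delta> (\<lambda>j. - \<beta> j / \<alpha> j)"
  have "eval_poly x (a j) = 0" for j
    using a(1)[of j] unfolding a(2)[of j] x_def
    by (simp add: eval_poly_add eval_poly_mult point_def)
  then have "A \<subseteq> {f. eval_poly x f = 0}" unfolding A by blast
  then have "differential_ideal_gen \<delta> A \<subseteq> {f. eval_poly x f = 0}"
    unfolding x_def by (intro differential_ideal_gen_minimal eval_kernel_ideal assms(1))
  then have "eval_poly x (H_prod R A) ^ n = 0"
    using n by (auto simp: eval_poly_power)
  then have "eval_poly x (H_prod R A) = 0" by simp
  moreover have "finite A" by (simp add: A)
  \<comment> \<open>Both factors evaluate to some \<open>\<alpha> j\<close>, which is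
    nonzero.\<close>
  moreover have "eval_poly x (initial R f * separant R f) \<noteq> 0" if "f \<in> A" for f
    using that a unfolding A by (auto simp: eval_poly_mult)
  ultimately show False by (simp add: H_prod_def eval_poly_prod)
qed

lemma H_prod_notin:
  fixes A I :: "('d, 'y, 'k::field) dpoly set"
  assumes "differential_field \<delta>" "differential_ideal \<delta> I" "characteristic_set R A I"
    and "I = saturation (differential_ideal_gen \<delta> A) (H_prod R A)"
  shows "H_prod R A \<notin> I"
proof
  assume "H_prod R A \<in> I"
  then obtain n where "H_prod R A ^ n * H_prod R A \<in> differential_ideal_gen \<delta> A"
    unfolding assms(4) by (auto simp: saturation_def)
  \<comment> \<open>Absorbing the extra factor into the power puts 1 into the saturation.\<close>
  then have "H_prod R A ^ Suc n * 1 \<in> differential_ideal_gen \<delta> A" by (simp add: mult.commute)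
  then have one: "1 \<in> saturation (differential_ideal_gen \<delta> A) (H_prod R A)"
    unfolding saturation_def by blast
  then have "1 \<in> I" using assms(4) by simp
  then have "f \<in> I" for f using differential_idealD(3)[OF assms(2), of 1 f] by simp
  then have "I = UNIV" by blast
  then show False using unit_ideal_not_saturated[OF assms(1)] assms(3) one by blast
qed

end

section \<open>Equality of characterizable differential ideals\<close>

theorem corollary3:
  fixes \<delta> :: "'d::finite \<Rightarrow> 'k::field_char_0 \<Rightarrow> 'k"
    and R :: "('d, 'y::finite) dvar rel"
    and A B I J :: "('d, 'y, 'k) dpoly set"
  assumes "differential_field \<delta>"
    and "ranking R"
    and "characterizable \<delta> R I"
    and "characteristic_set R A I"
    and "I = saturation (differential_ideal_gen \<delta> A) (H_prod R A)"
    and "characterizable \<delta> R J"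
    and "characteristic_set R B J"
    and "J = saturation (differential_ideal_gen \<delta> B) (H_prod R B)"
  shows "I = J \<longleftrightarrow>
    A \<subseteq> J \<and> B \<subseteq> I \<and> H_prod R A \<notin> J \<and> H_prod R B \<notin> I"
proof
  interpret ranked R by unfold_locales (rule assms(2))
  have ideal: "differential_ideal \<delta> I" "differential_ideal \<delta> J"
    using assms(3,6) by (simp_all add: characterizable_def)
  have A: "autoreduced R A" "A \<subseteq> I" and B: "autoreduced R B" "B \<subseteq> J"
    using assms(4,7) by (simp_all add: characteristic_set_def)
  {
    assume "I = J"
    then show "A \<subseteq> J \<and> B \<subseteq> I \<and> H_prod R A \<notin> J \<and> H_prod R B \<notin> I"
      using A(2) B(2) H_prod_notin[OF assms(1) ideal(1) assms(4,5)]
        H_prod_notin[OF assms(1) ideal(2) assms(7,8)]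
      by simp
  next
    assume cond: "A \<subseteq> J \<and> B \<subseteq> I \<and> H_prod R A \<notin> J \<and> H_prod R B \<notin> I"
    \<comment> \<open>Each set is an autoreduced subset of the other ideal, so minimality applies in
      both directions.\<close>
    then have "\<not> lower_rank R A B" "\<not> lower_rank R B A"
      using assms(4,7) A(1) B(1) by (simp_all add: characteristic_set_def)
    then have ranks: "poly_rank R ` A = poly_rank R ` B"
      by (rule same_ranks[OF A(1) B(1)])
    have "I \<subseteq> J"
      using cond by (intro characterizable_subset[OF ideal(1) assms(4) B(1) assms(8) ranks]) simp_all
    moreover have "J \<subseteq> I"
      using cond
      by (intro characterizable_subset[OF ideal(2) assms(7) A(1) assms(5) ranks[symmetric]]) simp_all
    ultimately show "I = J" by (rule subset_antisym)
  }
qed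

end
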